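(* Let $A$ be a $C^*$-algebra, let $a \in A$ be an element with closed range, and let $p_0$ and $q_0$ be the left and right defect projections of $a$. Then $a$ is a continuity point of the map $\mathbf{u}$ (from the set of closed range elements of $A$, with the norm topology, to $A$ with the norm topology) if and only if $0$ is the only closed range element of $p_0 A q_0$.
   Context: An element $a$ of a $C^*$-algebra $A$ has closed range if the spectrum of $a^*a$ is disjoint from the open interval $(0,\epsilon)$ for some $\epsilon > 0$ (equivalently, for any faithful representation $\pi$ of $A$ the operator $\pi(a)$ has closed range). For $a$ of closed range, $\mathbf{u}(a)$ denotes the partial isometry in its canonical polar decomposition: $a = \mathbf{u}(a)|a|$, where $|a| = (a^*a)^{1/2}$ and $\mathbf{u}(a)^*\mathbf{u}(a)$ is the right support projection of $a$ (the range projection of $a^*a$); it is well known that $\mathbf{u}(a)$ exists in $A$. The domain of $\mathbf{u}$ is the set of all closed range elements of $A$. Let $\mathbf{1}$ be the identity of $A$ if $A$ is unital, and the identity of the unitization $\widetilde{A}$ of $A$ if $A$ is non-unital. The left and right defect projections of a closed range element $a$ are $p_0 = \mathbf{1} - \mathbf{u}(a)\mathbf{u}(a)^*$ and $q_0 = \mathbf{1} - \mathbf{u}(a)^*\mathbf{u}(a)$. The set $p_0 A q_0 = \{p_0 x q_0 : x \in A\}$ is contained in $A$, and a closed range element of $p_0Aq_0$ is an element of $p_0 A q_0$ that has closed range as an element of $A$. *)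

theory Defs
  imports "HOL-Analysis.Analysis"
begin

section \<open>C*-algebras\<close>

class scaleC =
  fixes scaleC :: "complex \<Rightarrow> 'a \<Rightarrow> 'a"  (infixr "*\<^sub>C" 75)

text \<open>Neither a unit nor nontriviality is assumed. The submultiplicativity of the norm is part of
  \<^class>\<open>real_normed_algebra\<close>; \<open>scaleR_eq_scaleC\<close> ties the given real
  structure to the complex one.\<close>

class cstar_algebra = real_normed_algebra + banach + scaleC +
  fixes adj :: "'a \<Rightarrow> 'a"
  assumes scaleR_eq_scaleC: "scaleR r x = complex_of_real r *\<^sub>C x"
    and scaleC_add_right: "c *\<^sub>C (x + y) = c *\<^sub>C x + c *\<^sub>C y"
    and scaleC_add_left: "(c + d) *\<^sub>C x = c *\<^sub>C x + d *\<^sub>C x"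
    and scaleC_scaleC: "c *\<^sub>C d *\<^sub>C x = (c * d) *\<^sub>C x"
    and norm_scaleC: "norm (c *\<^sub>C x) = cmod c * norm x"
    and mult_scaleC_left: "(c *\<^sub>C x) * y = c *\<^sub>C (x * y)"
    and mult_scaleC_right: "x * (c *\<^sub>C y) = c *\<^sub>C (x * y)"
    and adj_adj: "adj (adj x) = x"
    and adj_add: "adj (x + y) = adj x + adj y"
    and adj_scaleC: "adj (c *\<^sub>C x) = cnj c *\<^sub>C adj x"
    and adj_mult: "adj (x * y) = adj y * adj x"
    and cstar_identity: "norm (adj x * x) = (norm x)\<^sup>2"


section \<open>The unitization and the ambient identity\<close>

text \<open>\<open>Unitize x c\<close> stands for the formal sum of \<open>x\<close> and \<open>c\<close> times the adjoined unit.
  Only the algebraic structure of the unitization is needed below, not its norm.\<close>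

datatype 'a unitization = Unitize (upart: 'a) (ucoeff: complex)

instantiation unitization :: (cstar_algebra) "{ring_1, scaleC}"
begin

definition "0 = Unitize 0 0"
definition "1 = Unitize 0 1"
definition "x + y = Unitize (upart x + upart y) (ucoeff x + ucoeff y)"
definition "- x = Unitize (- upart x) (- ucoeff x)"
definition "x - y = Unitize (upart x - upart y) (ucoeff x - ucoeff y)"
definition "c *\<^sub>C x = Unitize (c *\<^sub>C upart x) (c * ucoeff x)"
definition "x * y =
  Unitize (upart x * upart y + ucoeff x *\<^sub>C upart y + ucoeff y *\<^sub>C upart x) (ucoeff x * ucoeff y)"

instance
proof
  have scaleC_one: "1 *\<^sub>C x = x" for x :: 'a
    using scaleR_eq_scaleC[of 1 x] by simp
  have scaleC_zero: "0 *\<^sub>C x = 0" for x :: 'a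
    using scaleR_eq_scaleC[of 0 x] by simp
  have scaleC_zero_right: "c *\<^sub>C 0 = (0::'a)" for c
    using norm_scaleC[of c "0::'a"] by simp
  note defs = zero_unitization_def one_unitization_def plus_unitization_def
    uminus_unitization_def minus_unitization_def times_unitization_def
  fix x y z :: "'a unitization"
  show "x + y + z = x + (y + z)" "x + y = y + x" "0 + x = x" "- x + x = 0" "x - y = x + - y"
    by (simp_all add: defs ac_simps)
  show "x * y * z = x * (y * z)"
    by (simp add: defs algebra_simps scaleC_add_right scaleC_scaleC mult_scaleC_left
        mult_scaleC_right)
  show "1 * x = x" "x * 1 = x"
    by (simp_all add: defs scaleC_one scaleC_zero scaleC_zero_right)
  show "(x + y) * z = x * z + y * z" "x * (y + z) = x * y + x * z"
    by (simp_all add: defs algebra_simps scaleC_add_left scaleC_add_right)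
  show "(0::'a unitization) \<noteq> 1"
    by (simp add: defs)
qed

end

definition unitize :: "'a::cstar_algebra \<Rightarrow> 'a unitization"
  where "unitize x = Unitize x 0"

definition is_identity :: "'a::cstar_algebra \<Rightarrow> bool"
  where "is_identity e \<longleftrightarrow> (\<forall>x. e * x = x \<and> x * e = x)"

text \<open>The ambient unital algebra is \<open>A\<close> itself (seen inside its unitization) when \<open>A\<close> is unital,
  and the whole unitization otherwise; \<open>ambient_one\<close> is its identity.\<close>

definition ambient :: "'a::cstar_algebra unitization set"
  where "ambient = (if \<exists>e::'a. is_identity e then range unitize else UNIV)"

definition ambient_one :: "'a::cstar_algebra unitization"
  where "ambient_one = (if \<exists>e::'a. is_identity e then unitize (THE e. is_identity e) else 1)"

definition cstar_spectrum :: "'a::cstar_algebra \<Rightarrow> complex set"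
  where "cstar_spectrum x =
    {c. \<not> (\<exists>y\<in>ambient. (c *\<^sub>C ambient_one - unitize x) * y = ambient_one \<and>
                        y * (c *\<^sub>C ambient_one - unitize x) = ambient_one)}"


section \<open>Closed range elements and polar decomposition\<close>

definition closed_range :: "'a::cstar_algebra \<Rightarrow> bool"
  where "closed_range a \<longleftrightarrow>
    (\<exists>\<epsilon>::real. \<epsilon> > 0 \<and> cstar_spectrum (adj a * a) \<inter> complex_of_real ` {0<..<\<epsilon>} = {})"

definition positive :: "'a::cstar_algebra \<Rightarrow> bool"
  where "positive b \<longleftrightarrow> adj b = b \<and> cstar_spectrum b \<subseteq> complex_of_real ` {0..}"

definition cstar_abs :: "'a::cstar_algebra \<Rightarrow> 'a"
  where "cstar_abs a = (THE b. positive b \<and> b * b = adj a * a)"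

definition is_projection :: "'a::cstar_algebra \<Rightarrow> bool"
  where "is_projection p \<longleftrightarrow> adj p = p \<and> p * p = p"

definition partial_isometry :: "'a::cstar_algebra \<Rightarrow> bool"
  where "partial_isometry u \<longleftrightarrow> is_projection (adj u * u)"

text \<open>The right support projection is the least projection \<open>p\<close> with \<open>a * p = a\<close>, where
  \<open>p \<le> q\<close> for projections means \<open>p * q = p\<close>.\<close>

definition is_right_support :: "'a::cstar_algebra \<Rightarrow> 'a \<Rightarrow> bool"
  where "is_right_support p a \<longleftrightarrow> is_projection p \<and> a * p = a \<and>
    (\<forall>q. is_projection q \<and> a * q = a \<longrightarrow> p * q = p)"

text \<open>Meaningful for closed range elements only: these are the elements on which the map
  \<open>\<^bold>u\<close> is defined.\<close>

definition polar_part :: "'a::cstar_algebra \<Rightarrow> 'a"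
  where "polar_part a =
    (THE u. partial_isometry u \<and> a = u * cstar_abs a \<and> is_right_support (adj u * u) a)"


section \<open>Defect projections\<close>

definition left_defect :: "'a::cstar_algebra \<Rightarrow> 'a unitization"
  where "left_defect a = ambient_one - unitize (polar_part a * adj (polar_part a))"

definition right_defect :: "'a::cstar_algebra \<Rightarrow> 'a unitization"
  where "right_defect a = ambient_one - unitize (adj (polar_part a) * polar_part a)"

text \<open>The set \<open>p A q\<close> for \<open>p\<close>, \<open>q\<close> in the ambient unital algebra. It lies in \<open>A\<close>, which is an
  ideal there, so it is taken as a set of elements of \<open>A\<close>.\<close>

definition corner :: "'a::cstar_algebra unitization \<Rightarrow> 'a unitization \<Rightarrow> 'a set"
  where "corner p q = {y. \<exists>x. unitize y = p * unitize x * q}"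

end

theory Submission
  imports Defs
begin

text \<open>Closed range means von Neumann regular, equivalently having a Moore--Penrose inverse. Let \<open>m\<close> be
  the Moore--Penrose inverse of \<open>a\<close>; then \<open>\<^bold>u(a) = m\<^sup>*|a|\<close>. For \<open>b\<close> close to \<open>a\<close> put
  \<open>G = (1 + m (b - a))\<^sup>-\<^sup>1 m\<close>. The Schur complement \<open>s = b - b G b\<close> lies in \<open>p\<^sub>0 A q\<^sub>0\<close>, and if
  \<open>b y b = b\<close> then \<open>s y s = s\<close>, so \<open>s\<close> has closed range when \<open>b\<close> does. If the corner has no nonzero
  closed range element, then \<open>b G b = b\<close>, and the Moore--Penrose inverse of \<open>b\<close>, hence \<open>\<^bold>u(b)\<close>, is a
  continuous expression in \<open>b\<close>. Conversely, a nonzero closed range \<open>x\<close> in the corner is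
  orthogonal to \<open>a\<close>, so \<open>\<^bold>u(a + t x) = \<^bold>u(a) + \<^bold>u(x)\<close> for all \<open>t > 0\<close>, which does not tend to \<open>\<^bold>u(a)\<close>.\<close>

section \<open>Invertible elements of unital Banach algebras\<close>

text \<open>The obstacle to continuity is that inner inverses of \<open>b\<close> (solutions of
  \<open>b y b = b\<close>) need not stay bounded as \<open>b\<close> tends to \<open>a\<close>. The
  element \<open>G\<close> always converges to \<open>m\<close>, but it is only an outer inverse:
  \<open>G b G = G\<close>. The Moore-Penrose inverse is a continuous expression in \<open>b\<close>
  and any inner inverse of \<open>b\<close>, so everything reduces to \<open>b G b = b\<close>, and
  the Schur complement measures exactly this failure. Regularity is used instead of the spectral gap
  because it is algebraic and passes to the Schur complement by a computation. No functional
  calculus is used. The analytic core is that for a self-adjoint nonzero \<open>x\<close> one of the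
  two numbers \<open>norm x\<close>, \<open>- norm x\<close> lies in the spectrum; the positive
  cone, uniqueness of square roots and positivity of \<open>a^* a\<close> rest on it. All
  computations take place in the unitization, even if the algebra has its own unit \<open>e\<close>.
  Then \<open>1 - a m\<close> differs from the defect projection by \<open>1 - e\<close>, which
  annihilates the algebra, so the corners agree.\<close>

definition has_inverse :: "'a::monoid_mult \<Rightarrow> bool"
  where "has_inverse x \<longleftrightarrow> (\<exists>y. x * y = 1 \<and> y * x = 1)"

definition minv :: "'a::monoid_mult \<Rightarrow> 'a"
  where "minv x = (THE y. x * y = 1 \<and> y * x = 1)"

lemma has_inverseI: "x * y = 1 \<Longrightarrow> y * x = 1 \<Longrightarrow> has_inverse x"
  by (auto simp: has_inverse_def)

lemma minv_eq:
  assumes "x * y = 1" "y * x = 1"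
  shows "minv x = y"
  unfolding minv_def
proof (rule the_equality)
  fix z assume "x * z = 1 \<and> z * x = 1"
  then show "z = y"
    by (metis assms(1) mult.assoc mult_1_left mult_1_right)
qed (use assms in simp)

lemma minv_right: "has_inverse x \<Longrightarrow> x * minv x = 1"
  and minv_left: "has_inverse x \<Longrightarrow> minv x * x = 1"
  using minv_eq unfolding has_inverse_def by metis+

lemma has_inverse_mult:
  assumes "has_inverse x" "has_inverse y"
  shows "has_inverse (x * y)"
proof (rule has_inverseI)
  show "x * y * (minv y * minv x) = 1"
    by (metis assms minv_right mult.assoc mult_1_right)
  show "minv y * minv x * (x * y) = 1"
    by (metis assms minv_left mult.assoc mult_1_right)
qed

lemma has_inverse_factor:
  assumes "has_inverse (x * y)" "x * y = y * x"
  shows "has_inverse x"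
proof -
  obtain w where w: "x * y * w = 1" "w * (x * y) = 1"
    using assms(1) unfolding has_inverse_def by auto
  have r: "x * (y * w) = 1" and l: "(w * y) * x = 1"
    using w assms(2) by (metis mult.assoc)+
  then have "w * y = y * w"
    by (metis mult.assoc mult_1_left mult_1_right)
  with r l show ?thesis
    by (metis has_inverseI)
qed

lemma minv_commute:
  assumes "has_inverse x" "x * y = y * x"
  shows "minv x * y = y * minv x"
  by (metis assms minv_left minv_right mult.assoc mult_1_left mult_1_right)

lemma has_inverse_minus:
  fixes x :: "'a::ring_1"
  assumes "has_inverse x"
  shows "has_inverse (- x)"
  using assms unfolding has_inverse_def by (metis minus_mult_minus)

lemma has_inverse_scaleR:
  fixes x :: "'a::real_algebra_1"
  assumes "has_inverse x" "c \<noteq> 0"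
  shows "has_inverse (c *\<^sub>R x)"
proof (rule has_inverseI)
  show "c *\<^sub>R x * (inverse c *\<^sub>R minv x) = 1" "inverse c *\<^sub>R minv x * (c *\<^sub>R x) = 1"
    using assms by (simp_all add: minv_right minv_left)
qed

lemma has_inverse_one_minus:
  fixes x :: "'a::{real_normed_algebra_1,banach}"
  assumes "norm x < 1"
  shows "has_inverse (1 - x)"
proof -
  have s: "summable (\<lambda>n. x ^ n)"
    by (rule complete_algebra_summable_geometric[OF assms])
  define S where "S = (\<Sum>n. x ^ n)"
  have sh: "(\<Sum>n. x ^ Suc n) = S - 1"
    using suminf_split_head[OF s] by (simp add: S_def)
  have "x * S = S - 1"
    using suminf_mult[OF s, of x] sh by (simp add: S_def)
  moreover have "S * x = S - 1"
    using suminf_mult2[OF s, of x] sh by (simp add: S_def power_Suc2 del: power_Suc)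
  ultimately show ?thesis
    by (intro has_inverseI[of _ S]) (simp_all add: algebra_simps)
qed

lemma has_inverse_of_real_diff:
  fixes x :: "'a::{real_normed_algebra_1,banach}"
  assumes "norm x < \<bar>t\<bar>"
  shows "has_inverse (of_real t - x)"
proof -
  have t: "t \<noteq> 0" using assms by auto
  have "norm (inverse t *\<^sub>R x) < 1"
    using assms t by (simp add: field_simps)
  then have "has_inverse (t *\<^sub>R (1 - inverse t *\<^sub>R x))"
    using t by (intro has_inverse_scaleR has_inverse_one_minus)
  then show ?thesis
    using t by (simp add: algebra_simps of_real_def)
qed

section \<open>Perturbation of inverses\<close>

lemma has_inverse_near:
  fixes x :: "'a::{real_normed_algebra_1,banach}"
  assumes "has_inverse x" "norm (z - x) * norm (minv x) < 1"
  shows "has_inverse z"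
proof -
  have "norm (minv x * (x - z)) < 1"
    using assms(2) norm_mult_ineq[of "minv x" "x - z"]
    by (simp add: mult.commute norm_minus_commute)
  then have "has_inverse (x * (1 - minv x * (x - z)))"
    by (intro has_inverse_mult has_inverse_one_minus assms(1))
  moreover have "x * (1 - minv x * (x - z)) = z"
    using minv_right[OF assms(1)] by (simp add: algebra_simps flip: mult.assoc)
  ultimately show ?thesis by simp
qed

text \<open>The identity \<open>minv z - minv x = minv z * (x - z) * minv x\<close> still contains
  \<open>minv z\<close>; the bound 1/2 absorbs it and gives
  \<open>norm (minv z) \<le> 2 * norm (minv x)\<close>.\<close>

lemma norm_minv_near:
  fixes x :: "'a::{real_normed_algebra_1,banach}"
  assumes x: "has_inverse x" and z: "norm (z - x) * norm (minv x) \<le> 1/2"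
  shows "norm (minv z - minv x) \<le> 2 * (norm (minv x))\<^sup>2 * norm (z - x)"
proof -
  have hz: "has_inverse z"
    using has_inverse_near[OF x] z by simp
  have eq: "minv z - minv x = minv z * (x - z) * minv x"
    by (simp add: algebra_simps minv_right[OF x] minv_left[OF hz])
  have le: "norm (minv z - minv x) \<le> norm (minv z) * (norm (z - x) * norm (minv x))"
    unfolding eq
    by (metis (no_types) mult.assoc mult_left_mono norm_ge_zero norm_minus_commute norm_mult_ineq order_trans)
  also have "\<dots> \<le> norm (minv z) * (1/2)"
    by (intro mult_left_mono z) simp
  finally have "norm (minv z) \<le> 2 * norm (minv x)"
    using norm_triangle_ineq2[of "minv z" "minv x"] by linarith
  then have "norm (minv z) * (norm (z - x) * norm (minv x))
      \<le> 2 * norm (minv x) * (norm (z - x) * norm (minv x))"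
    by (intro mult_right_mono) simp_all
  with le show ?thesis
    by (simp add: power2_eq_square algebra_simps)
qed

lemma eventually_norm_minus_mult_less:
  fixes f :: "'b \<Rightarrow> 'a::real_normed_vector"
  assumes "(f \<longlongrightarrow> l) F" "e > 0"
  shows "eventually (\<lambda>z. norm (f z - l) * c < e) F"
proof -
  have "((\<lambda>z. norm (f z - l) * c) \<longlongrightarrow> 0 * c) F"
    by (intro tendsto_intros) (use assms(1) in \<open>simp add: tendsto_norm_zero LIM_zero\<close>)
  then show ?thesis
    using assms(2) order_tendstoD(2)[of _ 0 F e] by simp
qed

lemma eventually_has_inverse:
  fixes f :: "'b \<Rightarrow> 'a::{real_normed_algebra_1,banach}"
  assumes "(f \<longlongrightarrow> l) F" "has_inverse l"
  shows "eventually (\<lambda>z. has_inverse (f z)) F"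
  using eventually_norm_minus_mult_less[OF assms(1) zero_less_one, of "norm (minv l)"]
  by eventually_elim (rule has_inverse_near[OF assms(2)])

lemma tendsto_minv:
  fixes f :: "'b \<Rightarrow> 'a::{real_normed_algebra_1,banach}"
  assumes f: "(f \<longlongrightarrow> l) F" and l: "has_inverse l"
  shows "((\<lambda>z. minv (f z)) \<longlongrightarrow> minv l) F"
proof -
  have "eventually (\<lambda>z. norm (f z - l) * norm (minv l) < 1/2) F"
    by (rule eventually_norm_minus_mult_less[OF f]) simp
  then have "eventually (\<lambda>z. norm (minv (f z) - minv l) \<le> norm (f z - l) * (2 * (norm (minv l))\<^sup>2)) F"
    by eventually_elim (use norm_minv_near[OF l] in \<open>fastforce simp: mult_ac\<close>)
  moreover have "((\<lambda>z. norm (f z - l) * (2 * (norm (minv l))\<^sup>2)) \<longlongrightarrow> 0) F"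
    by (intro tendsto_mult_left_zero) (use f in \<open>simp add: tendsto_norm_zero LIM_zero\<close>)
  ultimately have "((\<lambda>z. minv (f z) - minv l) \<longlongrightarrow> 0) F"
    by (rule Lim_null_comparison)
  then show ?thesis by (simp add: LIM_zero_iff)
qed

section \<open>Elementary properties of the adjoint\<close>

lemma scaleC_one [simp]: "1 *\<^sub>C x = (x::'a::cstar_algebra)"
  using scaleR_eq_scaleC[of 1 x] by simp

lemma scaleC_zero_left [simp]: "0 *\<^sub>C x = (0::'a::cstar_algebra)"
  using scaleR_eq_scaleC[of 0 x] by simp

lemma scaleC_zero_right [simp]: "c *\<^sub>C 0 = (0::'a::cstar_algebra)"
  using norm_scaleC[of c "0::'a"] by simp

lemma scaleC_minus_left: "(- c) *\<^sub>C x = - (c *\<^sub>C (x::'a::cstar_algebra))"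
  using scaleC_add_left[of c "-c" x] by (simp add: eq_neg_iff_add_eq_0 add.commute)

lemma scaleC_minus_right: "c *\<^sub>C (- x) = - (c *\<^sub>C (x::'a::cstar_algebra))"
  using scaleC_add_right[of c x "-x"] by (simp add: eq_neg_iff_add_eq_0 add.commute)

lemma scaleC_diff_right: "c *\<^sub>C (x - y) = c *\<^sub>C x - c *\<^sub>C (y::'a::cstar_algebra)"
  using scaleC_add_right[of c x "-y"] by (simp add: scaleC_minus_right)

lemma adj_zero [simp]: "adj (0::'a::cstar_algebra) = 0"
  using adj_add[of 0 "0::'a"] by simp

lemma adj_minus: "adj (- x) = - adj (x::'a::cstar_algebra)"
  using adj_add[of x "-x"] by (simp add: eq_neg_iff_add_eq_0 add.commute)

lemma adj_diff: "adj (x - y) = adj x - adj (y::'a::cstar_algebra)"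
  using adj_add[of x "-y"] by (simp add: adj_minus)

lemma adj_scaleR: "adj (r *\<^sub>R x) = r *\<^sub>R adj (x::'a::cstar_algebra)"
  by (simp add: scaleR_eq_scaleC adj_scaleC)

lemmas adj_simps = adj_adj adj_add adj_minus adj_diff adj_scaleR adj_mult

lemma norm_adj [simp]: "norm (adj x) = norm (x::'a::cstar_algebra)"
proof -
  have le: "norm y \<le> norm (adj y)" for y :: 'a
    using cstar_identity[of y] norm_mult_ineq[of "adj y" y]
    by (cases "y = 0") (simp_all add: power2_eq_square)
  from le[of x] le[of "adj x"] show ?thesis by (simp add: adj_adj)
qed

lemma adj_mult_self_eq_0: "adj x * x = 0 \<longleftrightarrow> x = (0::'a::cstar_algebra)"
  using cstar_identity[of x] by auto

lemma selfadjoint_square_eq_0: "adj x = x \<Longrightarrow> x * x = 0 \<Longrightarrow> x = (0::'a::cstar_algebra)"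
  using adj_mult_self_eq_0[of x] by simp

lemma norm_selfadjoint_square:
  "adj x = x \<Longrightarrow> norm (x * x) = (norm (x::'a::cstar_algebra))\<^sup>2"
  using cstar_identity[of x] by simp

lemma bounded_linear_adj: "bounded_linear (adj :: 'a::cstar_algebra \<Rightarrow> 'a)"
  by (rule bounded_linear_intro[where K = 1]) (simp_all add: adj_simps)

lemmas tendsto_adj = bounded_linear.tendsto[OF bounded_linear_adj]

lemma bounded_linear_scaleC_left: "bounded_linear (\<lambda>c. c *\<^sub>C (x::'a::cstar_algebra))"
  by (rule bounded_linear_intro[where K = "norm x"])
    (simp_all add: scaleC_add_left norm_scaleC scaleR_eq_scaleC scaleC_scaleC scaleR_conv_of_real)

text \<open>The setting of the spectral analysis. A general \<open>cstar_algebra\<close> may lack a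
  unit and enters through its unitization, which is made an instance of this class below.\<close>

class unital_cstar_algebra = cstar_algebra + real_normed_algebra_1

lemma adj_one [simp]: "adj 1 = (1::'a::unital_cstar_algebra)"
  by (metis adj_adj adj_mult mult_1_left)

lemma adj_of_real [simp]: "adj (of_real r) = (of_real r::'a::unital_cstar_algebra)"
  by (simp add: of_real_def adj_scaleR)

lemma adj_power: "adj (x ^ n) = adj (x::'a::unital_cstar_algebra) ^ n"
  by (induction n) (simp_all add: adj_mult power_commutes)

lemma of_real_mult_commute:
  "of_real r * x = x * (of_real r::'a::real_algebra_1)"
  by (simp add: of_real_def)

section \<open>The spectrum of a self-adjoint element\<close>

lemma scaleC_of_real: "complex_of_real r *\<^sub>C 1 = (of_real r::'a::unital_cstar_algebra)"
  by (simp add: of_real_def scaleR_eq_scaleC)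

lemma has_inverse_scaleC:
  fixes x :: "'a::unital_cstar_algebra"
  assumes "has_inverse x" "c \<noteq> 0"
  shows "has_inverse (c *\<^sub>C x)"
proof (rule has_inverseI)
  show "c *\<^sub>C x * (inverse c *\<^sub>C minv x) = 1" "inverse c *\<^sub>C minv x * (c *\<^sub>C x) = 1"
    using assms
    by (simp_all add: mult_scaleC_left mult_scaleC_right scaleC_scaleC minv_right minv_left)
qed

lemma has_inverse_scaleC_diff:
  fixes x :: "'a::unital_cstar_algebra"
  assumes "norm x < cmod c"
  shows "has_inverse (c *\<^sub>C 1 - x)"
proof -
  have c: "c \<noteq> 0" using assms by auto
  have "norm (inverse c *\<^sub>C x) < 1"
    using assms c by (simp add: norm_scaleC norm_divide field_simps)
  then have "has_inverse (c *\<^sub>C (1 - inverse c *\<^sub>C x))"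
    using c by (intro has_inverse_scaleC has_inverse_one_minus)
  then show ?thesis
    using c by (simp add: scaleC_diff_right scaleC_scaleC)
qed

text \<open>Translating by a large imaginary multiple of the identity moves the number by more than it
  moves the norm, because \<open>\<parallel>y + is\<parallel>\<^sup>2 = \<parallel>y\<^sup>2 + s\<^sup>2\<parallel>\<close>.\<close>

lemma selfadjoint_has_inverse_nonreal:
  fixes x :: "'a::unital_cstar_algebra"
  assumes x: "adj x = x" and c: "Im c \<noteq> 0"
  shows "has_inverse (c *\<^sub>C 1 - x)"
proof -
  define y where "y = x - of_real (Re c)"
  \<comment> \<open>Chosen so that \<open>2 * Im c * s\<close> is \<open>(norm y)^2 + 1\<close>,
    which makes the square of \<open>Im c + s\<close> exceed \<open>(norm y)^2 + s^2\<close>. The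
    sign of \<open>s\<close> follows that of \<open>Im c\<close>.\<close>
  define s where "s = ((norm y)\<^sup>2 + 1) / (2 * Im c)"
  define w where "w = y + (\<i> * s) *\<^sub>C 1"
  have y: "adj y = y" by (simp add: y_def adj_diff x)
  have "adj w * w = y * y + of_real (s\<^sup>2)"
    by (simp add: w_def adj_add y adj_scaleC algebra_simps mult_scaleC_left mult_scaleC_right
        scaleC_scaleC scaleC_minus_left scaleC_diff_right power2_eq_square flip: scaleC_of_real)
  then have "(norm w)\<^sup>2 \<le> norm (y * y) + s\<^sup>2"
    by (metis cstar_identity norm_triangle_ineq norm_of_real abs_of_nonneg zero_le_power2)
  also have "\<dots> = (norm y)\<^sup>2 + s\<^sup>2"
    by (simp add: norm_selfadjoint_square y)
  also have "\<dots> < (Im c + s)\<^sup>2"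
  proof -
    have "2 * Im c * s = (norm y)\<^sup>2 + 1" using c by (simp add: s_def)
    then have "(Im c + s)\<^sup>2 = (Im c)\<^sup>2 + ((norm y)\<^sup>2 + 1) + s\<^sup>2"
      by (simp add: power2_sum)
    then show ?thesis using zero_le_power2[of "Im c"] by linarith
  qed
  finally have "norm w < \<bar>Im c + s\<bar>"
    by (metis abs_norm_cancel power2_less_imp_less power2_abs abs_ge_zero)
  then have "has_inverse ((\<i> * of_real (Im c + s)) *\<^sub>C 1 - w)"
    by (intro has_inverse_scaleC_diff) (simp add: norm_mult flip: of_real_add)
  moreover have "(\<i> * of_real (Im c + s)) *\<^sub>C 1 - w = c *\<^sub>C 1 - x"
    by (subst (3) complex_eq)
      (simp add: w_def y_def scaleC_add_left distrib_left flip: scaleC_of_real)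
  ultimately show ?thesis by simp
qed

lemma norm_selfadjoint_power_two_power:
  fixes x :: "'a::unital_cstar_algebra"
  assumes "adj x = x" "norm x = 1"
  shows "norm (x ^ 2 ^ k) = 1"
proof (induction k)
  case (Suc k)
  have "x ^ 2 ^ Suc k = x ^ 2 ^ k * x ^ 2 ^ k"
    by (simp add: mult_2 flip: power_add)
  then show ?case
    using Suc norm_selfadjoint_square[of "x ^ 2 ^ k"] assms by (simp add: adj_power)
qed (simp add: assms)

text \<open>Partial fractions for \<open>1 / (1 - y^2)\<close>. This is the doubling step by which
  means over roots of unity are computed two at a time.\<close>

lemma minv_one_minus_square:
  fixes y :: "'a::real_algebra_1"
  assumes "has_inverse (1 - y)" "has_inverse (1 + y)"
  shows "has_inverse (1 - y * y)" (is ?A)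
    and "minv (1 - y * y) = (1/2) *\<^sub>R (minv (1 - y) + minv (1 + y))" (is ?B)
proof -
  have f: "1 - y * y = (1 - y) * (1 + y)" "1 - y * y = (1 + y) * (1 - y)"
    by (simp_all add: algebra_simps)
  show ?A unfolding f(1) by (intro has_inverse_mult assms)
  have "(1 - y * y) * (minv (1 - y) + minv (1 + y))
      = (1 + y) * ((1 - y) * minv (1 - y)) + (1 - y) * ((1 + y) * minv (1 + y))"
    by (metis distrib_left f mult.assoc)
  then have 1: "(1 - y * y) * (minv (1 - y) + minv (1 + y)) = 2 *\<^sub>R 1"
    by (simp add: minv_right assms scaleR_2)
  have "(minv (1 - y) + minv (1 + y)) * (1 - y * y)
      = (minv (1 - y) * (1 - y)) * (1 + y) + (minv (1 + y) * (1 + y)) * (1 - y)"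
    by (metis distrib_right f mult.assoc)
  then have 2: "(minv (1 - y) + minv (1 + y)) * (1 - y * y) = 2 *\<^sub>R 1"
    by (simp add: minv_left assms scaleR_2)
  show ?B by (rule minv_eq) (simp_all add: 1 2)
qed

text \<open>Rickart's argument. The resolvent \<open>(1 - z x)\<^sup>-\<^sup>1\<close> would be uniformly continuous on the closed
  unit disc, and so would be, uniformly in \<open>k\<close>, its means over \<open>2\<^sup>k\<close>-th roots of unity, which are
  \<open>(1 - z\<^sup>N x\<^sup>N)\<^sup>-\<^sup>1\<close> with \<open>N = 2\<^sup>k\<close>. Inside the disc these tend to \<open>1\<close>, hence also on the
  boundary, which contradicts \<open>\<parallel>x\<^sup>N\<parallel> = 1\<close>.\<close>

lemma selfadjoint_norm_one_spectrum:
  fixes x :: "'a::unital_cstar_algebra"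
  assumes x: "adj x = x" "norm x = 1" and inv: "has_inverse (1 - x)" "has_inverse (1 + x)"
  shows False
proof -
  \<comment> \<open>Here \<open>z\<close> stands for the N-th power of the variable, N = 2^k;
    \<open>g k z\<close> is the mean of the resolvent over the N-th roots of \<open>z\<close>, so
    passing from \<open>k\<close> to \<open>k + 1\<close> only takes square roots.\<close>
  define g where "g k z = minv (1 - z *\<^sub>C (x ^ 2 ^ k))" for k z
  have I0: "has_inverse (1 - z *\<^sub>C x)" if z: "cmod z \<le> 1" for z
  proof (cases "Im z = 0")
    case True
    then obtain r where r: "z = of_real r"
      by (metis complex_is_Real_iff Reals_cases)
    consider "\<bar>r\<bar> < 1" | "r = 1" | "r = -1"
      using z r by force
    then show ?thesis
    proof cases
      case 1
      then show ?thesis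
        by (intro has_inverse_one_minus) (simp add: norm_scaleC x r)
    qed (use inv r in \<open>simp_all add: scaleC_minus_left\<close>)
  next
    case False
    then have z0: "z \<noteq> 0" and "Im (inverse z) \<noteq> 0"
      by (auto simp: Im_divide)
    then have "has_inverse (z *\<^sub>C (inverse z *\<^sub>C 1 - x))"
      by (intro has_inverse_scaleC selfadjoint_has_inverse_nonreal x)
    then show ?thesis
      using z0 by (simp add: scaleC_diff_right scaleC_scaleC)
  qed
  have sq: "(csqrt z *\<^sub>C x ^ 2 ^ k) * (csqrt z *\<^sub>C x ^ 2 ^ k) = z *\<^sub>C x ^ 2 ^ Suc k" for z k
    by (simp add: mult_scaleC_left mult_scaleC_right scaleC_scaleC mult_2 power_add
        flip: power2_eq_square[of "csqrt z"])
  have I: "has_inverse (1 - z *\<^sub>C x ^ 2 ^ k)" if "cmod z \<le> 1" for k z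
    using that
  proof (induction k arbitrary: z)
    case 0
    then show ?case using I0 by simp
  next
    case (Suc k)
    have "cmod (csqrt z) \<le> 1" using Suc.prems by (simp add: norm_csqrt)
    then have "has_inverse (1 - csqrt z *\<^sub>C x ^ 2 ^ k)" "has_inverse (1 + csqrt z *\<^sub>C x ^ 2 ^ k)"
      using Suc.IH[of "csqrt z"] Suc.IH[of "- csqrt z"] by (simp_all add: scaleC_minus_left)
    from minv_one_minus_square(1)[OF this] show ?case
      by (simp only: sq)
  qed
  have g_step: "g (Suc k) (w * w) = (1/2) *\<^sub>R (g k w + g k (- w))" if "cmod w \<le> 1" for k w
  proof -
    have e: "(w *\<^sub>C x ^ 2 ^ k) * (w *\<^sub>C x ^ 2 ^ k) = (w * w) *\<^sub>C x ^ 2 ^ Suc k"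
      by (simp add: mult_scaleC_left mult_scaleC_right scaleC_scaleC mult_2 flip: power_add)
    have "has_inverse (1 - w *\<^sub>C x ^ 2 ^ k)" "has_inverse (1 + w *\<^sub>C x ^ 2 ^ k)"
      using I[of w k] I[of "- w" k] that by (simp_all add: scaleC_minus_left)
    from minv_one_minus_square(2)[OF this] show ?thesis
      unfolding g_def e by (simp add: scaleC_minus_left)
  qed
  have "continuous_on (cball 0 1) (g 0)"
    unfolding continuous_on_def g_def
  proof
    fix z :: complex assume "z \<in> cball 0 1"
    then show "((\<lambda>z. minv (1 - z *\<^sub>C x ^ 2 ^ 0)) \<longlongrightarrow> minv (1 - z *\<^sub>C x ^ 2 ^ 0)) (at z within cball 0 1)"
      by (intro tendsto_minv I tendsto_intros bounded_linear.tendsto[OF bounded_linear_scaleC_left])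
        auto
  qed
  then have "uniformly_continuous_on (cball 0 1) (g 0)"
    by (rule compact_uniformly_continuous) simp
  then obtain d where d: "d > 0" and D: "\<And>z w. cmod z \<le> 1 \<Longrightarrow> cmod w \<le> 1 \<Longrightarrow> dist w z < d
      \<Longrightarrow> dist (g 0 w) (g 0 z) < 1/4"
    unfolding uniformly_continuous_on_def by (metis dist_0_norm mem_cball zero_less_divide_1_iff zero_less_numeral)
  define r where "r = max 0 (1 - d/2)"
  have r: "0 \<le> r" "r < 1" "1 - r < d" using d by (auto simp: r_def)
  \<comment> \<open>Squaring the variable squares the radius, hence the factor
    \<open>r ^ 2 ^ k\<close> at level \<open>k\<close>. Averaging two differences of norm at most
    1/4 keeps the bound, so it is uniform in \<open>k\<close>.\<close>
  have close: "norm (g k z - g k (of_real (r ^ 2 ^ k) * z)) \<le> 1/4" if "cmod z \<le> 1" for k z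
    using that
  proof (induction k arbitrary: z)
    case 0
    have "z - of_real r * z = of_real (1 - r) * z"
      by (simp add: algebra_simps)
    then have "dist z (of_real r * z) = (1 - r) * cmod z"
      using r by (simp add: dist_norm norm_mult del: of_real_diff)
    also have "\<dots> \<le> 1 - r"
      using 0 r by (simp add: mult_left_le)
    finally have "dist z (of_real r * z) < d"
      using r by simp
    moreover have "cmod (of_real r * z) \<le> 1"
      using 0 r by (simp add: norm_mult mult_le_one)
    ultimately show ?case
      using D[of "of_real r * z" z] 0 by (simp add: dist_norm)
  next
    case (Suc k)
    define w where "w = csqrt z"
    have w: "cmod w \<le> 1" "z = w * w"
      using Suc.prems by (simp_all add: w_def norm_csqrt flip: power2_eq_square)
    define q where "q = complex_of_real (r ^ 2 ^ k)"
    have "cmod q \<le> 1" using r by (simp add: q_def norm_power power_le_one del: of_real_power)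
    then have qw: "cmod (q * w) \<le> 1" using w by (simp add: norm_mult mult_le_one)
    have qq: "of_real (r ^ 2 ^ Suc k) * z = (q * w) * (q * w)"
      by (simp add: q_def w mult_2 power_add algebra_simps)
    have "g (Suc k) z - g (Suc k) (of_real (r ^ 2 ^ Suc k) * z)
        = (1/2) *\<^sub>R ((g k w - g k (q * w)) + (g k (- w) - g k (q * (- w))))"
      unfolding qq unfolding w(2) g_step[OF w(1)] g_step[OF qw] by (simp add: algebra_simps)
    also have "norm \<dots> \<le> (1/2) * (1/4 + 1/4)"
      using norm_triangle_mono[OF Suc.IH[OF w(1)] Suc.IH[of "- w"]] w(1)
      by (simp add: q_def)
    finally show ?case by simp
  qed
  \<comment> \<open>With 1/9, \<open>norm (y - 1)\<close> is at most \<open>norm y / 9\<close>,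
    hence at most 1/8. Adding 1/4 gives 3/8 for \<open>w\<close>, and
    \<open>v = (w - 1) * (1 - v)\<close> then has norm at most 3/4, against
    \<open>norm v = 1\<close>.\<close>
  have "\<exists>k. r ^ k < 1/9" using r by (intro real_arch_pow_inv) auto
  then obtain k where "r ^ k < 1/9" by blast
  moreover have "r ^ 2 ^ k \<le> r ^ k"
    using r by (intro power_decreasing) (auto simp: less_imp_le)
  ultimately have rk: "r ^ 2 ^ k < 1/9" by simp
  define v where "v = x ^ 2 ^ k"
  have v: "norm v = 1" unfolding v_def by (rule norm_selfadjoint_power_two_power[OF x])
  define y where "y = g k (of_real (r ^ 2 ^ k))"
  define w where "w = g k 1"
  have rk1: "cmod (of_real (r ^ 2 ^ k)) \<le> 1" using r by (simp add: norm_power power_le_one)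
  have "y * (1 - (of_real (r ^ 2 ^ k)) *\<^sub>C v) = 1"
    using minv_left[OF I[OF rk1, of k]] by (simp add: y_def g_def v_def)
  then have y1: "y - 1 = y * ((of_real (r ^ 2 ^ k)) *\<^sub>C v)"
    by (simp add: algebra_simps)
  have "norm (y - 1) \<le> norm y * norm ((of_real (r ^ 2 ^ k)) *\<^sub>C v)"
    unfolding y1 by (rule norm_mult_ineq)
  also have "\<dots> = norm y * r ^ 2 ^ k"
    using r by (simp add: norm_scaleC v norm_power)
  also have "\<dots> \<le> norm y * (1/9)"
    using rk by (intro mult_left_mono) auto
  finally have "norm (y - 1) \<le> 1/8"
    using norm_triangle_ineq2[of y 1] by simp
  moreover have "norm (w - y) \<le> 1/4"
    using close[of 1 k] by (simp add: w_def y_def)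
  ultimately have w1: "norm (w - 1) \<le> 3/8"
    using norm_triangle_ineq[of "w - y" "y - 1"] by simp
  have "w * (1 - v) = 1"
    using minv_left[OF I[of 1 k]] by (simp add: w_def g_def v_def)
  then have "v = (w - 1) * (1 - v)"
    by (simp add: algebra_simps)
  then have "norm v \<le> norm (w - 1) * norm (1 - v)"
    by (metis norm_mult_ineq)
  also have "\<dots> \<le> 3/8 * 2"
    using norm_triangle_ineq4[of 1 v] v w1 by (intro mult_mono) auto
  finally show False using v by simp
qed

text \<open>Rescaling to norm one. In this form the result serves as a vanishing test: it yields the
  norm criterion for positivity, the antisymmetry of the cone, and the vanishing of the part of
  \<open>a^* a\<close> below a gap.\<close>

lemma selfadjoint_eq_0_if_spectrum:
  fixes x :: "'a::unital_cstar_algebra"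
  assumes x: "adj x = x"
    and inv: "has_inverse (of_real (norm x) - x)" "has_inverse (of_real (norm x) + x)"
  shows "x = 0"
proof (rule ccontr)
  assume "x \<noteq> 0"
  then have n: "norm x > 0" by simp
  define y where "y = inverse (norm x) *\<^sub>R x"
  have "1 - y = inverse (norm x) *\<^sub>R (of_real (norm x) - x)"
    "1 + y = inverse (norm x) *\<^sub>R (of_real (norm x) + x)"
    using n by (simp_all add: y_def of_real_def scaleR_diff_right scaleR_add_right)
  then have "has_inverse (1 - y)" "has_inverse (1 + y)"
    using inv n by (simp_all add: has_inverse_scaleR)
  moreover have "adj y = y" "norm y = 1"
    using n by (simp_all add: y_def adj_scaleR x)
  ultimately show False
    using selfadjoint_norm_one_spectrum by blast
qed

section \<open>Positive elements and square roots\<close>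

text \<open>Spectrum in the nonnegative reals. Only negative reals are tested, because
  \<open>selfadjoint_has_inverse_nonreal\<close> already makes the spectrum of a self-adjoint
  element real.\<close>

definition cpos :: "'a::unital_cstar_algebra \<Rightarrow> bool"
  where "cpos x \<longleftrightarrow> adj x = x \<and> (\<forall>t>0. has_inverse (x + of_real t))"

lemma cposI_norm:
  fixes x :: "'a::unital_cstar_algebra"
  assumes "adj x = x" "norm (of_real t - x) \<le> t"
  shows "cpos x"
  unfolding cpos_def
proof (intro conjI allI impI assms(1))
  fix s :: real assume "s > 0"
  moreover have "0 \<le> t"
    using norm_ge_zero assms(2) by (rule order_trans)
  ultimately have "has_inverse (of_real (t + s) - (of_real t - x))"
    using assms(2) by (intro has_inverse_of_real_diff) simp
  then show "has_inverse (x + of_real s)"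
    by (simp add: algebra_simps)
qed

text \<open>Suppose \<open>y = norm x - x\<close> had norm above \<open>norm x\<close>. Then
  \<open>norm y - y\<close> is invertible by positivity of \<open>x\<close> and
  \<open>norm y + y\<close> by the Neumann series, so \<open>y = 0\<close>. With
  \<open>cposI_norm\<close> this turns positivity into a ball condition, from which closure under
  sums is immediate.\<close>

lemma cpos_norm:
  fixes x :: "'a::unital_cstar_algebra"
  assumes x: "cpos x" and t: "norm x \<le> t"
  shows "norm (of_real t - x) \<le> t"
proof -
  define y where "y = of_real (norm x) - x"
  have y: "adj y = y" using x by (simp add: y_def cpos_def adj_diff)
  have "norm y \<le> norm x"
  proof (rule ccontr)
    assume less: "\<not> norm y \<le> norm x"
    then have "has_inverse (x + of_real (norm y - norm x))"
      using x by (simp add: cpos_def del: of_real_diff)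
    then have "has_inverse (of_real (norm y) - y)"
      by (simp add: y_def algebra_simps)
    moreover have "x \<noteq> 0"
      using less by (auto simp: y_def)
    then have "has_inverse (of_real (norm y + norm x) - x)"
      by (intro has_inverse_of_real_diff) (use less in auto)
    then have "has_inverse (of_real (norm y) + y)"
      by (simp add: y_def algebra_simps)
    ultimately have "y = 0"
      using y by (intro selfadjoint_eq_0_if_spectrum)
    with less show False by simp
  qed
  have "norm (of_real (t - norm x) + y) \<le> (t - norm x) + norm y"
    by (rule norm_triangle_le) (use t in \<open>simp del: of_real_diff\<close>)
  then show ?thesis
    using \<open>norm y \<le> norm x\<close> by (simp add: y_def algebra_simps)
qed

lemma cpos_adj: "cpos x \<Longrightarrow> adj x = x"
  by (simp add: cpos_def)

lemma cpos_add:
  assumes "cpos x" "cpos y"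
  shows "cpos (x + y)"
proof (rule cposI_norm)
  show "adj (x + y) = x + y"
    using assms by (simp add: cpos_adj adj_add)
  have "norm ((of_real (norm x) - x) + (of_real (norm y) - y)) \<le> norm x + norm y"
    by (intro norm_triangle_mono cpos_norm assms order_refl)
  then show "norm (of_real (norm x + norm y) - (x + y)) \<le> norm x + norm y"
    by (simp add: algebra_simps)
qed

lemma cpos_scaleR:
  assumes "cpos x" "r \<ge> 0"
  shows "cpos (r *\<^sub>R x)"
proof (rule cposI_norm)
  show "adj (r *\<^sub>R x) = r *\<^sub>R x"
    using assms by (simp add: cpos_adj adj_scaleR)
  have "norm (r *\<^sub>R (of_real (norm x) - x)) \<le> r * norm x"
    using cpos_norm[OF assms(1) order_refl] assms(2) by (simp add: mult_left_mono)
  then show "norm (of_real (r * norm x) - r *\<^sub>R x) \<le> r * norm x"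
    by (simp add: algebra_simps of_real_def)
qed

text \<open>For \<open>t > 0\<close> the element \<open>x^2 + t\<close> factors as
  \<open>(c - x) * (- c - x)\<close> with \<open>c\<close> the imaginary number of square
  \<open>- t\<close>; both factors are invertible.\<close>

lemma cpos_square:
  fixes x :: "'a::unital_cstar_algebra"
  assumes x: "adj x = x"
  shows "cpos (x * x)"
  unfolding cpos_def
proof (intro conjI allI impI)
  fix t :: real assume t: "t > 0"
  define c where "c = \<i> * of_real (sqrt t)"
  have "has_inverse (c *\<^sub>C 1 - x)" "has_inverse ((- c) *\<^sub>C 1 - x)"
    using t by (intro selfadjoint_has_inverse_nonreal x; simp add: c_def)+
  then have "has_inverse ((c *\<^sub>C 1 - x) * ((- c) *\<^sub>C 1 - x))"
    by (rule has_inverse_mult)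
  moreover have cc: "c * c = - of_real t"
    using t by (simp add: c_def algebra_simps flip: of_real_mult)
  have "(c *\<^sub>C 1 - x) * ((- c) *\<^sub>C 1 - x) = x * x - (c * c) *\<^sub>C 1"
    by (simp add: algebra_simps mult_scaleC_left mult_scaleC_right scaleC_scaleC scaleC_minus_left
        scaleC_minus_right scaleC_diff_right)
  ultimately show "has_inverse (x * x + of_real t)"
    by (simp add: cc scaleC_minus_left scaleC_of_real)
qed (simp add: adj_mult x)

lemma cpos_antisym:
  fixes x :: "'a::unital_cstar_algebra"
  assumes "cpos x" "cpos (- x)"
  shows "x = 0"
proof (rule ccontr)
  assume "x \<noteq> 0"
  then have "has_inverse (x + of_real (norm x))" "has_inverse (- x + of_real (norm x))"
    using assms by (simp_all add: cpos_def)
  then have "x = 0"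
    using assms(1) by (intro selfadjoint_eq_0_if_spectrum) (simp_all add: cpos_adj algebra_simps)
  with \<open>x \<noteq> 0\<close> show False by simp
qed

section \<open>Square roots of positive elements by a quadratic iteration\<close>

lemma cpos_one_minus_norm_le_1:
  assumes "adj x = x" "norm x \<le> 1"
  shows "cpos (1 - x)"
  by (rule cposI_norm[where t = 1]) (use assms in \<open>simp_all add: adj_diff\<close>)

text \<open>The limit \<open>w\<close> of this iteration satisfies \<open>2 w = z + w\<^sup>2\<close>, so \<open>(1 - w)\<^sup>2 = 1 - z\<close>.\<close>

fun sqrt_iter :: "'a::real_algebra_1 \<Rightarrow> nat \<Rightarrow> 'a" where
  "sqrt_iter z 0 = 0"
| "sqrt_iter z (Suc n) = (1/2) *\<^sub>R (z + sqrt_iter z n * sqrt_iter z n)"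

definition sqrt_iter_lim :: "'a::real_normed_algebra_1 \<Rightarrow> 'a"
  where "sqrt_iter_lim z = lim (sqrt_iter z)"

lemma sqrt_iter_real_bounds: "0 \<le> sqrt_iter (1::real) n" "sqrt_iter (1::real) n \<le> 1"
proof (induction n)
  case (Suc n)
  case 1 then show ?case by simp
  case 2 then show ?case using Suc mult_le_one[of "sqrt_iter (1::real) n" "sqrt_iter 1 n"] by simp
qed simp_all

text \<open>The iterates are polynomials in \<open>z\<close> with nonnegative coefficients, so the
  scalar sequence at 1 is a majorant. This gives convergence up to the boundary of the unit ball,
  where the iteration has no contraction constant below 1.\<close>

lemma norm_sqrt_iter_le:
  fixes z :: "'a::real_normed_algebra_1"
  assumes "norm z \<le> 1"
  shows "norm (sqrt_iter z n) \<le> sqrt_iter 1 n"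
proof (induction n)
  case (Suc n)
  have "norm (sqrt_iter z n * sqrt_iter z n) \<le> sqrt_iter 1 n * sqrt_iter 1 n"
    using Suc sqrt_iter_real_bounds(1)
    by (meson norm_mult_ineq order_trans mult_mono norm_ge_zero)
  then have "norm (z + sqrt_iter z n * sqrt_iter z n) \<le> 1 + sqrt_iter 1 n * sqrt_iter 1 n"
    using assms by (intro norm_triangle_mono)
  then show ?case by simp
qed simp

lemma sqrt_iter_commute:
  assumes "c * z = z * c"
  shows "c * sqrt_iter z n = sqrt_iter z n * c"
proof (induction n)
  case (Suc n)
  have "c * (sqrt_iter z n * sqrt_iter z n) = sqrt_iter z n * sqrt_iter z n * c"
    by (metis Suc mult.assoc)
  then show ?case by (simp add: distrib_left distrib_right assms)
qed simp

lemma norm_sqrt_iter_Suc_diff_le: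
  fixes z :: "'a::real_normed_algebra_1"
  assumes z: "norm z \<le> 1"
  shows "norm (sqrt_iter z (Suc n) - sqrt_iter z n) \<le> sqrt_iter 1 (Suc n) - sqrt_iter 1 n"
proof (induction n)
  case (Suc n)
  define a b where "a = sqrt_iter z (Suc n)" and "b = sqrt_iter z n"
  define s t where "s = sqrt_iter (1::real) (Suc n)" and "t = sqrt_iter (1::real) n"
  have ab: "a * b = b * a"
    unfolding a_def b_def by (intro sqrt_iter_commute sqrt_iter_commute[symmetric] refl)
  have "a * a - b * b = (a - b) * (a + b)"
    by (simp add: algebra_simps ab)
  then have "norm (a * a - b * b) \<le> norm (a - b) * norm (a + b)"
    by (simp add: norm_mult_ineq)
  also have "\<dots> \<le> (s - t) * (s + t)"
    using Suc norm_sqrt_iter_le[OF z, of n] norm_sqrt_iter_le[OF z, of "Suc n"]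
    unfolding a_def[symmetric] b_def[symmetric] s_def[symmetric] t_def[symmetric]
    using norm_ge_zero[of "a - b"] norm_ge_zero[of "a + b"]
    by (intro mult_mono norm_triangle_mono) linarith+
  also have "\<dots> = s * s - t * t"
    by (simp add: algebra_simps)
  finally have le: "norm (a * a - b * b) \<le> s * s - t * t" .
  have "sqrt_iter z (Suc (Suc n)) - a = (1/2) *\<^sub>R (z + a * a) - (1/2) *\<^sub>R (z + b * b)"
    by (simp only: sqrt_iter.simps a_def b_def)
  also have "\<dots> = (1/2) *\<^sub>R (a * a - b * b)"
    by (simp add: algebra_simps)
  also have "norm \<dots> \<le> (1/2) * (s * s - t * t)"
    using le by simp
  also have "\<dots> = sqrt_iter 1 (Suc (Suc n)) - s"
    unfolding sqrt_iter.simps(2)[of 1 "Suc n"] s_def[symmetric]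
    by (simp add: s_def t_def) (simp add: field_simps)
  finally show ?case
    unfolding a_def s_def .
qed (use z in simp)

lemma norm_sqrt_iter_diff_le:
  fixes z :: "'a::real_normed_algebra_1"
  assumes z: "norm z \<le> 1" and "m \<le> n"
  shows "norm (sqrt_iter z n - sqrt_iter z m) \<le> sqrt_iter 1 n - sqrt_iter 1 m"
  using \<open>m \<le> n\<close>
proof (induction n rule: dec_induct)
  case (step n)
  then show ?case
    using norm_triangle_mono[OF norm_sqrt_iter_Suc_diff_le[OF z, of n] step.IH]
    by (simp del: sqrt_iter.simps)
qed (use z in simp)

lemma incseq_sqrt_iter_real: "incseq (sqrt_iter (1::real))"
proof (rule incseq_SucI)
  fix n
  show "sqrt_iter (1::real) n \<le> sqrt_iter 1 (Suc n)"
    using order_trans[OF norm_ge_zero norm_sqrt_iter_Suc_diff_le[of "1::real" n]]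
    by (simp del: sqrt_iter.simps)
qed

lemma convergent_sqrt_iter_real: "convergent (sqrt_iter (1::real))"
  unfolding convergent_def
  by (rule incseq_convergent[OF incseq_sqrt_iter_real, of 1]) (use sqrt_iter_real_bounds in auto)

lemma sqrt_iter_LIMSEQ:
  fixes z :: "'a::{real_normed_algebra_1,banach}"
  assumes z: "norm z \<le> 1"
  shows "sqrt_iter z \<longlonglongrightarrow> sqrt_iter_lim z"
proof -
  have "Cauchy (sqrt_iter (1::real))"
    using convergent_sqrt_iter_real by (rule convergent_Cauchy)
  have "Cauchy (sqrt_iter z)"
  proof (rule CauchyI)
    fix e :: real assume "e > 0"
    then obtain M where M: "\<And>m n. m \<ge> M \<Longrightarrow> n \<ge> M \<Longrightarrow> norm (sqrt_iter (1::real) m - sqrt_iter 1 n) < e"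
      using CauchyD[OF \<open>Cauchy (sqrt_iter (1::real))\<close>] by blast
    have "norm (sqrt_iter z m - sqrt_iter z n) < e" if "m \<ge> M" "n \<ge> M" for m n
    proof (cases m n rule: linorder_le_cases)
      case le
      then show ?thesis
        using norm_sqrt_iter_diff_le[OF z le] M[OF that] by (simp add: norm_minus_commute)
    next
      case ge
      then show ?thesis
        using norm_sqrt_iter_diff_le[OF z ge] M[OF that] by simp
    qed
    then show "\<exists>M. \<forall>m\<ge>M. \<forall>n\<ge>M. norm (sqrt_iter z m - sqrt_iter z n) < e"
      by blast
  qed
  then show ?thesis
    unfolding sqrt_iter_lim_def using Cauchy_convergent convergent_LIMSEQ_iff by blast
qed

text \<open>The error of the n-th iterate is at most the tail \<open>L - sqrt_iter 1 n\<close> of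
  the scalar sequence, which does not depend on \<open>z\<close>.\<close>

lemma continuous_on_sqrt_iter_lim:
  "continuous_on (cball 0 1) (sqrt_iter_lim :: 'a::{real_normed_algebra_1,banach} \<Rightarrow> 'a)"
proof (rule uniform_limit_theorem)
  have "continuous_on (cball 0 1) (\<lambda>z::'a. sqrt_iter z n)" for n
    by (induction n) (auto intro!: continuous_intros)
  then show "\<forall>\<^sub>F n in sequentially. continuous_on (cball 0 1) (\<lambda>z::'a. sqrt_iter z n)"
    by simp
  obtain L where L: "sqrt_iter (1::real) \<longlonglongrightarrow> L"
    using convergent_sqrt_iter_real by (auto simp: convergent_def)
  have dist: "dist (sqrt_iter z n) (sqrt_iter_lim z) \<le> L - sqrt_iter 1 n" if "z \<in> cball 0 1" for n and z :: 'a
  proof -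
    have z: "norm z \<le> 1" using that by simp
    have "(\<lambda>m. norm (sqrt_iter z m - sqrt_iter z n)) \<longlonglongrightarrow> norm (sqrt_iter_lim z - sqrt_iter z n)"
      by (intro tendsto_intros sqrt_iter_LIMSEQ z)
    moreover have "(\<lambda>m. sqrt_iter 1 m - sqrt_iter 1 n) \<longlonglongrightarrow> L - sqrt_iter 1 n"
      by (intro tendsto_intros L)
    ultimately have "norm (sqrt_iter_lim z - sqrt_iter z n) \<le> L - sqrt_iter 1 n"
      using norm_sqrt_iter_diff_le[OF z] by (intro LIMSEQ_le) auto
    then show ?thesis by (simp add: dist_norm norm_minus_commute)
  qed
  show "uniform_limit (cball 0 1) (\<lambda>n z::'a. sqrt_iter z n) sqrt_iter_lim sequentially"
  proof (rule uniform_limitI)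
    fix e :: real assume "e > 0"
    then have "\<forall>\<^sub>F n in sequentially. dist (sqrt_iter 1 n) L < e"
      using L by (simp add: tendsto_iff)
    then show "\<forall>\<^sub>F n in sequentially. \<forall>z\<in>cball 0 (1::real). dist (sqrt_iter z n) (sqrt_iter_lim (z::'a)) < e"
    proof eventually_elim
      case (elim n)
      show ?case
      proof
        fix z :: 'a assume "z \<in> cball 0 1"
        then show "dist (sqrt_iter z n) (sqrt_iter_lim z) < e"
          using dist[of z n] elim by (simp add: dist_real_def)
      qed
    qed
  qed
qed simp

lemma sqrt_iter_lim_eq:
  fixes z :: "'a::{real_normed_algebra_1,banach}"
  assumes z: "norm z \<le> 1"
  shows "2 *\<^sub>R sqrt_iter_lim z = z + sqrt_iter_lim z * sqrt_iter_lim z"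
proof -
  note lim = sqrt_iter_LIMSEQ[OF z]
  have "(\<lambda>n. sqrt_iter z (Suc n)) \<longlonglongrightarrow> (1/2) *\<^sub>R (z + sqrt_iter_lim z * sqrt_iter_lim z)"
    unfolding sqrt_iter.simps by (intro tendsto_intros lim)
  then have eq: "sqrt_iter_lim z = (1/2) *\<^sub>R (z + sqrt_iter_lim z * sqrt_iter_lim z)"
    using LIMSEQ_unique LIMSEQ_Suc[OF lim] by blast
  show ?thesis
    using arg_cong[OF eq, of "\<lambda>v. 2 *\<^sub>R v"] by simp
qed

lemma norm_sqrt_iter_lim_le:
  fixes z :: "'a::{real_normed_algebra_1,banach}"
  assumes z: "norm z \<le> 1"
  shows "norm (sqrt_iter_lim z) \<le> 1"
  by (rule LIMSEQ_le_const2[OF tendsto_norm[OF sqrt_iter_LIMSEQ[OF z]]])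
    (use norm_sqrt_iter_le[OF z] sqrt_iter_real_bounds in \<open>meson order_trans\<close>)

lemma sqrt_iter_lim_commute:
  fixes z :: "'a::{real_normed_algebra_1,banach}"
  assumes z: "norm z \<le> 1" and c: "c * z = z * c"
  shows "c * sqrt_iter_lim z = sqrt_iter_lim z * c"
proof (rule LIMSEQ_unique)
  show "(\<lambda>n. c * sqrt_iter z n) \<longlonglongrightarrow> c * sqrt_iter_lim z"
    by (intro tendsto_intros sqrt_iter_LIMSEQ z)
  show "(\<lambda>n. c * sqrt_iter z n) \<longlonglongrightarrow> sqrt_iter_lim z * c"
    unfolding sqrt_iter_commute[OF c] by (intro tendsto_intros sqrt_iter_LIMSEQ z)
qed

lemma adj_sqrt_iter_lim:
  fixes z :: "'a::unital_cstar_algebra"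
  assumes z: "norm z \<le> 1" "adj z = z"
  shows "adj (sqrt_iter_lim z) = sqrt_iter_lim z"
proof -
  have "adj (sqrt_iter z n) = sqrt_iter z n" for n
    by (induction n) (simp_all add: adj_simps z(2))
  then have "sqrt_iter z \<longlonglongrightarrow> adj (sqrt_iter_lim z)"
    using tendsto_adj[OF sqrt_iter_LIMSEQ[OF z(1)]] by simp
  then show ?thesis
    using LIMSEQ_unique sqrt_iter_LIMSEQ[OF z(1)] by blast
qed

text \<open>A scale \<open>t\<close> above \<open>norm x\<close> moves \<open>1 - x / t\<close> into
  the unit ball, for \<open>x\<close> positive. It is kept as a parameter because continuity is read
  off with \<open>t\<close> fixed in a neighbourhood.\<close>

definition scaled_sqrt :: "real \<Rightarrow> 'a::unital_cstar_algebra \<Rightarrow> 'a"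
  where "scaled_sqrt t x = sqrt t *\<^sub>R (1 - sqrt_iter_lim (1 - inverse t *\<^sub>R x))"

lemma scaled_sqrt:
  fixes x :: "'a::unital_cstar_algebra"
  assumes x: "cpos x" and t: "norm x \<le> t" "t > 0"
  shows "cpos (scaled_sqrt t x)" "scaled_sqrt t x * scaled_sqrt t x = x"
    "c * x = x * c \<Longrightarrow> c * scaled_sqrt t x = scaled_sqrt t x * c"
    "norm (1 - inverse t *\<^sub>R x) \<le> 1"
proof -
  define z where "z = 1 - inverse t *\<^sub>R x"
  define w where "w = sqrt_iter_lim z"
  have "t *\<^sub>R z = of_real t - x"
    using t by (simp add: z_def algebra_simps of_real_def)
  then have "norm (t *\<^sub>R z) \<le> t"
    using cpos_norm[OF x t(1)] by simp
  then show z: "norm (1 - inverse t *\<^sub>R x) \<le> 1"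
    using t by (simp flip: z_def)
  note z = this[folded z_def]
  have adjz: "adj z = z"
    using x by (simp add: z_def adj_simps cpos_adj)
  have adjw: "adj w = w"
    unfolding w_def by (rule adj_sqrt_iter_lim[OF z adjz])
  have r: "scaled_sqrt t x = sqrt t *\<^sub>R (1 - w)"
    by (simp add: scaled_sqrt_def w_def z_def)
  have "norm w \<le> 1"
    unfolding w_def by (rule norm_sqrt_iter_lim_le[OF z])
  then show "cpos (scaled_sqrt t x)"
    unfolding r using t by (intro cpos_scaleR cpos_one_minus_norm_le_1 adjw) auto
  have "(1 - w) * (1 - w) = 1 - (2 *\<^sub>R w - w * w)"
    by (simp add: algebra_simps scaleR_2)
  also have "2 *\<^sub>R w - w * w = z"
    using sqrt_iter_lim_eq[OF z] by (simp flip: w_def)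
  finally have "(1 - w) * (1 - w) = inverse t *\<^sub>R x"
    by (simp add: z_def)
  then show "scaled_sqrt t x * scaled_sqrt t x = x"
    using t by (simp add: r flip: power2_eq_square)
  show "c * scaled_sqrt t x = scaled_sqrt t x * c" if "c * x = x * c"
  proof -
    have "c * z = z * c" by (simp add: z_def algebra_simps that)
    then have "c * w = w * c" unfolding w_def by (rule sqrt_iter_lim_commute[OF z])
    then show ?thesis by (simp add: r algebra_simps)
  qed
qed

text \<open>A square root \<open>e\<close> of \<open>x\<close> commutes with \<open>d\<close>, so
  \<open>d * x * d\<close> is the square of the self-adjoint \<open>d * e\<close>. The commuting
  case comes first because it is an ingredient of the positivity of \<open>a^* a\<close>.\<close>

lemma cpos_conj_selfadjoint:
  fixes x d :: "'a::unital_cstar_algebra"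
  assumes x: "cpos x" and d: "adj d = d" "d * x = x * d"
  shows "cpos (d * x * d)"
proof -
  define e where "e = scaled_sqrt (norm x + 1) x"
  have e: "cpos e" "e * e = x" "d * e = e * d"
    unfolding e_def by (intro scaled_sqrt x d(2); simp add: add_nonneg_pos)+
  have "d * x * d = (d * e) * (d * e)"
    by (metis e(2,3) mult.assoc)
  moreover have "adj (d * e) = d * e"
    using e d by (simp add: adj_mult cpos_adj)
  ultimately show ?thesis
    by (simp add: cpos_square)
qed

text \<open>With \<open>d = y - r\<close>, the positive elements \<open>d y d\<close> and
  \<open>d r d\<close> add up to \<open>d (y + r) d = 0\<close>, so both vanish. Their difference is
  \<open>d^3\<close>, and a self-adjoint nilpotent element is zero.\<close>

lemma cpos_sqrt_unique:
  fixes y r :: "'a::unital_cstar_algebra"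
  assumes y: "cpos y" and r: "cpos r" and eq: "y * y = r * r" and com: "y * r = r * y"
  shows "y = r"
proof -
  define d where "d = y - r"
  have d: "adj d = d" using y r by (simp add: d_def adj_diff cpos_adj)
  have com': "d * y = y * d" "d * r = r * d"
    by (simp_all add: d_def algebra_simps com)
  have "d * (y + r) = 0"
    by (simp add: d_def algebra_simps com eq)
  then have "d * (y + r) * d = 0"
    by simp
  then have "d * y * d + d * r * d = 0"
    by (simp only: distrib_left distrib_right)
  then have m: "d * r * d = - (d * y * d)"
    by (simp add: eq_neg_iff_add_eq_0 add.commute)
  have "cpos (d * y * d)" "cpos (- (d * y * d))"
    unfolding m[symmetric] by (intro cpos_conj_selfadjoint y r d com')+
  then have z: "d * y * d = 0"
    by (rule cpos_antisym)
  have "d * d * d = d * y * d - d * r * d"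
    by (simp add: d_def algebra_simps)
  then have "d * d * d = 0"
    using z m by simp
  then have "(d * d * d) * d = 0"
    by simp
  then have "(d * d) * (d * d) = 0"
    by (simp only: mult.assoc)
  then have "d * d = 0"
    by (rule selfadjoint_square_eq_0[rotated]) (simp_all add: adj_mult d)
  then have "d = 0"
    by (rule selfadjoint_square_eq_0[OF d])
  then show ?thesis by (simp add: d_def)
qed

definition psqrt :: "'a::unital_cstar_algebra \<Rightarrow> 'a"
  where "psqrt x = scaled_sqrt (norm x + 1) x"

lemma psqrt:
  assumes "cpos x"
  shows cpos_psqrt: "cpos (psqrt x)" and psqrt_square: "psqrt x * psqrt x = x"
    and psqrt_commute: "c * x = x * c \<Longrightarrow> c * psqrt x = psqrt x * c"
  unfolding psqrt_def by (intro scaled_sqrt assms; simp add: add_nonneg_pos)+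

lemma psqrt_eqI:
  fixes x y :: "'a::unital_cstar_algebra"
  assumes y: "cpos y" "y * y = x"
  shows "psqrt x = y"
proof -
  have x: "cpos x"
    using cpos_square[of y] y by (simp add: cpos_adj)
  have "y * x = x * y"
    by (metis y(2) mult.assoc)
  from psqrt_commute[OF x this] show ?thesis
    using cpos_sqrt_unique[OF y(1) cpos_psqrt[OF x]] psqrt_square[OF x] y(2) by simp
qed

lemma continuous_on_psqrt: "continuous_on {x. cpos x} (psqrt :: 'a::unital_cstar_algebra \<Rightarrow> 'a)"
  unfolding continuous_on_def
proof
  fix a :: 'a assume "a \<in> {x. cpos x}"
  then have a: "cpos a" by simp
  \<comment> \<open>The slack 1 lets one scale serve all \<open>x\<close> near \<open>a\<close>.
    \<open>psqrt x\<close> uses a scale varying with \<open>x\<close>, but uniqueness of positive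
    roots identifies the two.\<close>
  define t where "t = norm a + 1"
  have t: "norm a \<le> t" "t > 0" by (simp_all add: t_def add_nonneg_pos)
  define f where "f x = 1 - inverse t *\<^sub>R x" for x :: 'a
  have "norm (f a) \<le> 1" unfolding f_def by (rule scaled_sqrt(4)[OF a t])

  have f: "(f \<longlongrightarrow> f a) (at a within {x. cpos x})"
    unfolding f_def by (intro tendsto_intros)
  have ev: "\<forall>\<^sub>F x in at a within {x. cpos x}. cpos x \<and> norm x \<le> t"
  proof -
    have "\<forall>\<^sub>F x in at a within {x. cpos x}. norm x < t"
      by (rule order_tendstoD(2)[OF tendsto_norm[OF tendsto_ident_at]]) (simp add: t_def)
    moreover have "\<forall>\<^sub>F x in at a within {x. cpos x}. cpos x"
      by (simp add: eventually_at_filter)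
    ultimately show ?thesis
      by eventually_elim simp
  qed
  then have "\<forall>\<^sub>F x in at a within {x. cpos x}. f x \<in> cball 0 1"
    by eventually_elim (use scaled_sqrt(4) t in \<open>auto simp: f_def\<close>)
  then have lim: "((\<lambda>x. sqrt_iter_lim (f x)) \<longlongrightarrow> sqrt_iter_lim (f a)) (at a within {x. cpos x})"
    by (rule continuous_on_tendsto_compose[OF continuous_on_sqrt_iter_lim f, rotated])
      (use \<open>norm (f a) \<le> 1\<close> in simp)
  have lim': "(scaled_sqrt t \<longlongrightarrow> scaled_sqrt t a) (at a within {x. cpos x})"
    unfolding scaled_sqrt_def
    by (rule tendsto_scaleR[OF tendsto_const tendsto_diff[OF tendsto_const lim[unfolded f_def]]])
  have eq: "scaled_sqrt t x = psqrt x" if "cpos x" "norm x \<le> t" for x :: 'a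
    by (rule psqrt_eqI[symmetric, OF scaled_sqrt(1,2)[OF that t(2)]])
  have "\<forall>\<^sub>F x in at a within {x. cpos x}. scaled_sqrt t x = psqrt x"
    using ev by eventually_elim (simp add: eq)
  from Lim_transform_eventually[OF lim' this]
  show "(psqrt \<longlongrightarrow> psqrt a) (at a within {x. cpos x})"
    unfolding eq[OF a t(1)] .
qed

lemma tendsto_psqrt:
  fixes f :: "'b \<Rightarrow> 'a::unital_cstar_algebra"
  assumes f: "(f \<longlongrightarrow> l) F" and pos: "\<forall>\<^sub>F x in F. cpos (f x)" "cpos l"
  shows "((\<lambda>x. psqrt (f x)) \<longlongrightarrow> psqrt l) F"
  by (rule continuous_on_tendsto_compose[OF continuous_on_psqrt f]) (use pos in auto)

text \<open>With \<open>k = |x|\<close>, the product \<open>(k - x)\<^sup>2 = 2 k (k - x)\<close> yields an explicit inverse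
  of \<open>k - x + t\<close>.\<close>

lemma cpos_abs_minus:
  fixes x :: "'a::unital_cstar_algebra"
  assumes x: "adj x = x"
  shows "cpos (psqrt (x * x) - x)"
proof -
  define k where "k = psqrt (x * x)"
  have k: "cpos k" "k * k = x * x" "x * k = k * x"
    unfolding k_def using x
    by (intro cpos_psqrt psqrt_square psqrt_commute cpos_square; simp add: mult.assoc)+
  define n where "n = k - x"
  have nn: "n * n = 2 *\<^sub>R k * n"
    by (simp add: n_def algebra_simps k scaleR_2)
  have nk: "n * k = k * n"
    by (simp add: n_def algebra_simps k)
  have "has_inverse (n + of_real t)" if t: "t > 0" for t
  proof -
    have "has_inverse (2 *\<^sub>R k + of_real t)"
      using cpos_scaleR[OF k(1), of 2] t by (simp add: cpos_def)
    note M = this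
    define b where "b = minv (2 *\<^sub>R k + of_real t)"
    have b: "b * (2 *\<^sub>R k + of_real t) = 1" "(2 *\<^sub>R k + of_real t) * b = 1"
      unfolding b_def using M by (simp_all only: minv_left minv_right)
    \<comment> \<open>Since \<open>b\<close> inverts \<open>2 k + t\<close>, this gives
      \<open>b n (n + t) = n\<close>, hence \<open>(1 - b n) (n + t) = t\<close>; dividing by
      \<open>t\<close> produces the inverse.\<close>
    have nt: "n * (n + of_real t) = (2 *\<^sub>R k + of_real t) * n"
      by (simp add: distrib_left distrib_right nn of_real_mult_commute)
    have bn: "b * n = n * b"
      unfolding b_def by (intro minv_commute M)
        (simp add: distrib_left distrib_right nk of_real_mult_commute)
    have 1: "b * n * (n + of_real t) = n"
      by (simp add: mult.assoc nt) (simp add: b flip: mult.assoc)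
    have com: "(n + of_real t) * (b * n) = b * n * (n + of_real t)"
      by (simp add: distrib_left distrib_right bn mult.assoc of_real_mult_commute)
    show ?thesis
    proof (rule has_inverseI)
      show "(inverse t *\<^sub>R (1 - b * n)) * (n + of_real t) = 1"
        using t by (simp add: left_diff_distrib 1) (simp add: of_real_def)
      then show "(n + of_real t) * (inverse t *\<^sub>R (1 - b * n)) = 1"
        by (simp add: right_diff_distrib left_diff_distrib com)
    qed
  qed
  then show ?thesis
    using k x by (simp add: cpos_def n_def k_def[symmetric] adj_diff)
qed

text \<open>The nonzero spectra of \<open>x * y\<close> and \<open>y * x\<close> agree: if
  \<open>w\<close> inverts \<open>x y + t\<close>, then \<open>(1 - y w x) / t\<close> inverts
  \<open>y x + t\<close>.\<close>

lemma has_inverse_mult_swap: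
  fixes x y :: "'a::real_algebra_1"
  assumes inv: "has_inverse (x * y + of_real t)" and t: "t \<noteq> 0"
  shows "has_inverse (y * x + of_real t)"
proof -
  obtain w where w: "w * (x * y + of_real t) = 1" "(x * y + of_real t) * w = 1"
    using inv unfolding has_inverse_def by blast
  have 1: "(y * x + of_real t) * y = y * (x * y + of_real t)"
    "x * (y * x + of_real t) = (x * y + of_real t) * x"
    by (simp_all add: algebra_simps of_real_mult_commute)
  have "(y * x + of_real t) * (y * w * x) = y * x"
    by (metis 1(1) mult.assoc mult_1_left w(2))
  moreover have "(y * w * x) * (y * x + of_real t) = y * x"
    by (metis 1(2) mult.assoc mult_1_left w(1))
  ultimately show ?thesis
    using t by (intro has_inverseI[of _ "inverse t *\<^sub>R (1 - y * w * x)"])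
      (simp_all add: right_diff_distrib left_diff_distrib, simp_all add: of_real_def)
qed

text \<open>Kaplansky's argument: with \<open>n\<close> twice the negative part of \<open>a\<^sup>*a\<close> and \<open>y = a n\<close>, both
  \<open>- y\<^sup>*y\<close> and hence \<open>- y y\<^sup>*\<close> are positive, while \<open>y\<^sup>*y + y y\<^sup>*\<close> is a sum of squares.\<close>

lemma cpos_adj_mult_self:
  fixes a :: "'a::unital_cstar_algebra"
  shows "cpos (adj a * a)"
proof -
  define h where "h = adj a * a"
  have h: "adj h = h" by (simp add: h_def adj_simps)
  define k where "k = psqrt (h * h)"
  have k: "cpos k" "k * k = h * h" "h * k = k * h"
    unfolding k_def using h
    by (intro cpos_psqrt psqrt_square psqrt_commute cpos_square; simp add: mult.assoc)+
  define n where "n = k - h"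
  have n: "cpos n" unfolding n_def k_def by (rule cpos_abs_minus[OF h])
  have an: "adj n = n" using n by (rule cpos_adj)
  \<comment> \<open>Together with \<open>n = k - h\<close> this gives \<open>2 n h = - n^2\<close>,
    so that \<open>y^* y = n h n\<close> is minus one half of the positive element
    \<open>n^3\<close>.\<close>
  have "n * (k + h) = 0"
    by (simp add: n_def algebra_simps k)
  then have "2 *\<^sub>R (n * h) = - (n * n)"
    by (simp add: n_def algebra_simps scaleR_2)
  then have nh: "2 *\<^sub>R (n * h * n) = - (n * n * n)"
    using mult_scaleR_left[of 2 "n * h" n] by simp
  define y where "y = a * n"
  have yy: "2 *\<^sub>R (adj y * y) = - (n * n * n)"
    using nh by (simp add: y_def adj_mult an h_def mult.assoc)
  have n3: "cpos (n * n * n)"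
    by (intro cpos_conj_selfadjoint n an refl)
  then have "cpos ((1/2) *\<^sub>R (n * n * n))"
    by (rule cpos_scaleR) simp
  moreover have myy: "(1/2) *\<^sub>R (n * n * n) = - (adj y * y)"
    using arg_cong[OF yy, of "\<lambda>v. (1/2) *\<^sub>R v"] by (simp add: equation_minus_iff)
  ultimately have neg: "cpos (- (adj y * y))"
    by simp
  have "cpos (- (y * adj y))" (is "cpos (- ?b)")
    unfolding cpos_def
  proof (intro conjI allI impI)
    fix t :: real assume "t > 0"
    then have "has_inverse (adj y * (- y) + of_real t)"
      using neg by (simp add: cpos_def)
    then have "has_inverse ((- y) * adj y + of_real t)"
      by (rule has_inverse_mult_swap) (use \<open>t > 0\<close> in simp)
    then show "has_inverse (- (y * adj y) + of_real t)" by simp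
  qed (simp add: adj_simps)
  moreover have "cpos (adj y * y + y * adj y)"
  proof -
    \<comment> \<open>Up to sign, twice the real and the imaginary part of \<open>y\<close>; the
      mixed terms cancel in \<open>s^2 + d^2\<close>.\<close>
    define s d where "s = y + adj y" and "d = \<i> *\<^sub>C (y - adj y)"
    have "adj s = s" "adj d = d"
      by (simp_all add: s_def d_def adj_simps adj_scaleC add.commute scaleC_minus_left scaleC_diff_right)
    then have "cpos ((1/2) *\<^sub>R (s * s + d * d))"
      by (intro cpos_scaleR cpos_add cpos_square) auto
    moreover have "d * d = - ((y - adj y) * (y - adj y))"
      by (simp add: d_def mult_scaleC_left mult_scaleC_right scaleC_scaleC scaleC_minus_left)
    then have "s * s + d * d = 2 *\<^sub>R (adj y * y + y * adj y)"
      by (simp add: s_def algebra_simps scaleR_2)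
    ultimately show ?thesis by simp
  qed
  ultimately have "cpos ((adj y * y + ?b) + - ?b)"
    by (simp only: cpos_add)
  then have "cpos (adj y * y)"
    by (simp only: add_diff_cancel_right' diff_conv_add_uminus[symmetric])
  then have "adj y * y = 0"
    by (rule cpos_antisym[OF _ neg])
  then have "n * n * n = 0"
    using yy by simp
  then have "(n * n * n) * n = 0"
    by simp
  then have "(n * n) * (n * n) = 0"
    by (simp only: mult.assoc)
  then have "n * n = 0"
    by (rule selfadjoint_square_eq_0[rotated]) (simp_all add: adj_mult an)
  then have "n = 0"
    by (rule selfadjoint_square_eq_0[OF an])
  then show ?thesis
    using k(1) by (simp add: n_def h_def)
qed

section \<open>Moore--Penrose inverses\<close>

definition gapped :: "'a::unital_cstar_algebra \<Rightarrow> bool"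
  where "gapped a \<longleftrightarrow> (\<exists>e>0. \<forall>t. 0 < t \<and> t < e \<longrightarrow> has_inverse (of_real t - adj a * a))"

definition moore_penrose :: "'a::cstar_algebra \<Rightarrow> 'a \<Rightarrow> bool"
  where "moore_penrose a m \<longleftrightarrow>
    a * m * a = a \<and> m * a * m = m \<and> adj (a * m) = a * m \<and> adj (m * a) = m * a"

lemma minv_selfadjoint:
  fixes x :: "'a::unital_cstar_algebra"
  assumes "has_inverse x" "adj x = x"
  shows "adj (minv x) = minv x"
proof -
  have "x * adj (minv x) = 1" "adj (minv x) * x = 1"
    using arg_cong[OF minv_left[OF assms(1)], of adj] arg_cong[OF minv_right[OF assms(1)], of adj]
    by (simp_all add: adj_mult assms(2))
  then show ?thesis
    by (rule minv_eq[symmetric])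
qed

text \<open>With \<open>k = a\<^sup>*a - t\<close> for a \<open>t\<close> in the gap, \<open>s = k |k|\<^sup>-\<^sup>1\<close> is a symmetry, and \<open>q = (1 + s) / 2\<close> is the
  spectral projection of \<open>a\<^sup>*a\<close> above the gap.\<close>

lemma gapped_imp_regular:
  fixes a :: "'a::unital_cstar_algebra"
  assumes "gapped a"
  shows "\<exists>y. a * y * a = a"
proof -
  obtain e where e: "e > 0" and inv: "\<And>t. 0 < t \<Longrightarrow> t < e \<Longrightarrow> has_inverse (of_real t - adj a * a)"
    using assms unfolding gapped_def by blast
  define h where "h = adj a * a"
  have hpos: "cpos h" unfolding h_def by (rule cpos_adj_mult_self)
  note hadj = cpos_adj[OF hpos]
  define t where "t = e / 2"
  have t: "t > 0" "t < e" using e by (simp_all add: t_def)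
  define k where "k = h - of_real t"
  have kadj: "adj k = k" by (simp add: k_def adj_diff hadj)
  have kinv: "has_inverse k"
    using has_inverse_minus[OF inv[OF t]] by (simp add: k_def h_def)
  have hk: "h * k = k * h"
    by (simp add: k_def algebra_simps of_real_mult_commute)
  define j where "j = psqrt (k * k)"
  have kkpos: "cpos (k * k)" by (rule cpos_square[OF kadj])
  have jpos: "cpos j" and jj: "j * j = k * k"
    unfolding j_def by (rule cpos_psqrt[OF kkpos], rule psqrt_square[OF kkpos])
  have kj: "k * j = j * k" unfolding j_def
    by (rule psqrt_commute[OF kkpos]) (simp add: mult.assoc)
  have hj: "h * j = j * h"
  proof -
    have "h = k + of_real t" by (simp add: k_def)
    then show ?thesis by (simp add: distrib_left distrib_right kj of_real_mult_commute)
  qed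
  have jinv: "has_inverse j"
    by (rule has_inverse_factor[of j j]) (simp_all add: jj has_inverse_mult kinv)
  define i where "i = minv j"
  have ij: "i * j = 1" "j * i = 1" "adj i = i"
    unfolding i_def by (rule minv_left minv_right minv_selfadjoint jinv cpos_adj jpos)+
  have ik: "i * k = k * i" and ih: "i * h = h * i"
    unfolding i_def by (intro minv_commute jinv kj[symmetric] hj[symmetric])+
  define s where "s = k * i"
  have sadj: "adj s = s" by (simp add: s_def adj_mult kadj ij ik)
  have "s * s = (k * k) * (i * i)"
    by (simp add: s_def mult.assoc) (metis ik mult.assoc)
  also have "\<dots> = j * (j * i) * i" by (simp add: jj[symmetric] mult.assoc)
  finally have ss: "s * s = 1" by (simp add: ij)
  have sj: "s * j = k" by (simp add: s_def mult.assoc ij)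
  have js: "j * s = k" by (simp add: s_def ij kj[symmetric] flip: mult.assoc) (simp add: mult.assoc ij)
  have hs: "h * s = s * h" by (metis s_def hk ih mult.assoc)
  define q r where "q = (1/2) *\<^sub>R (1 + s)" and "r = (1/2) *\<^sub>R (1 - s)"
  have qr: "q = 1 - r" "q + r = 1"
    by (simp_all add: q_def r_def scaleR_add_right scaleR_diff_right algebra_simps)
      (simp_all flip: scaleR_add_left add.assoc)
  have adjs: "adj q = q" "adj r = r" by (simp_all add: q_def r_def adj_simps sadj)
  have rr: "r * r = r"
    by (simp add: r_def algebra_simps ss) (simp flip: scaleR_add_left)
  have qq: "q * q = q" by (simp add: qr(1) algebra_simps rr)
  have hr: "h * r = r * h" by (simp add: r_def algebra_simps hs)
  have jr: "j * r = r * j" by (simp add: r_def algebra_simps js sj)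
  have "s * r = - r" "s * q = q" by (simp_all add: q_def r_def algebra_simps ss)
  then have kr: "k * r = - (j * r)" and kq: "k * q = j * q"
    using js by (metis mult.assoc mult_minus_right)+
  \<comment> \<open>The part of \<open>a^* a\<close> below the gap. With \<open>n = norm m\<close>,
    invertibility of \<open>n + m\<close> is positivity of \<open>m\<close>, so only
    \<open>n - m\<close> needs work to conclude \<open>m = 0\<close>.\<close>
  define m where "m = h * r"
  have mpos: "cpos m"
    using cpos_conj_selfadjoint[OF hpos adjs(2) hr[symmetric]]
    by (simp add: m_def hr[symmetric] mult.assoc rr)
  have "m = 0"
  proof (rule ccontr)
    assume "m \<noteq> 0"
    define n where "n = norm m"
    have n: "n > 0" using \<open>m \<noteq> 0\<close> by (simp add: n_def)
    have "has_inverse (of_real n - m)"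
    proof (cases "n < e")
      \<comment> \<open>Here \<open>n\<close> lies in the gap and \<open>n - h\<close> has an
        inverse \<open>w\<close>. It serves under \<open>r\<close>, while under \<open>q\<close> the
        element \<open>n - m\<close> is the scalar \<open>n\<close>.\<close>
      case True
      define w where "w = minv (of_real n - h)"
      have hn: "has_inverse (of_real n - h)" using inv[OF n True] by (simp add: h_def)
      have wr: "w * r = r * w"
        unfolding w_def
        by (rule minv_commute[OF hn]) (simp add: left_diff_distrib right_diff_distrib hr of_real_mult_commute)
      have wn: "(of_real n - h) * w = 1" "w * (of_real n - h) = 1"
        unfolding w_def using hn by (simp_all only: minv_left minv_right)
      have m_eq: "of_real n - m = (of_real n - h) * r + n *\<^sub>R q"
        by (simp add: m_def qr(1) algebra_simps of_real_def)
      have rq: "r * q = 0" "q * r = 0" by (simp_all add: qr(1) algebra_simps rr)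
      have r1: "r * (of_real n - h) = (of_real n - h) * r"
        by (simp add: left_diff_distrib right_diff_distrib hr of_real_mult_commute)
      show ?thesis
      proof (rule has_inverseI)
        have "(of_real n - m) * (w * r + (1/n) *\<^sub>R q)
            = (of_real n - h) * (r * r) * w + (of_real n - h) * (1/n) *\<^sub>R (r * q) + n *\<^sub>R (q * r) * w + q * q"
          unfolding m_eq wr using n by (simp add: distrib_left distrib_right mult.assoc scaleR_add_right)
        also have "\<dots> = 1"
          by (simp add: rr rq qq mult.assoc flip: wr) (simp add: wn qr flip: mult.assoc)
        finally show "(of_real n - m) * (w * r + (1/n) *\<^sub>R q) = 1" .
        have "q * ((of_real n - h) * r) = 0"
          by (simp add: rq flip: r1 mult.assoc)
        moreover have "w * (r * ((of_real n - h) * r)) = r"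
          by (simp add: rr wn flip: r1 mult.assoc)
            (simp add: rr wn r1 mult.assoc, simp add: wn flip: mult.assoc)
        ultimately show "(w * r + (1/n) *\<^sub>R q) * (of_real n - m) = 1"
          unfolding m_eq using n
          by (simp add: distrib_left distrib_right mult.assoc scaleR_add_right rq qq qr(2) add.commute[of r])
      qed
    next
      \<comment> \<open>Now \<open>n > t\<close>. Under \<open>r\<close> the modulus
        \<open>j\<close> of \<open>h - t\<close> is \<open>t - h\<close>, so
        \<open>t - m = t q + r j r\<close> is positive, and adding \<open>n - t > 0\<close> makes it
        invertible.\<close>
      case False
      have "cpos (t *\<^sub>R (q * q) + r * j * r)"
        using t by (intro cpos_add cpos_scaleR cpos_square cpos_conj_selfadjoint jpos adjs jr[symmetric]) simp
      moreover have "t *\<^sub>R (q * q) + r * j * r = of_real t - m"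
      proof -
        have "r * j * r = - (k * r)"
          by (simp add: kr jr[symmetric] mult.assoc rr)
        then show ?thesis
          unfolding qq by (simp add: m_def k_def qr(1) algebra_simps of_real_def)
      qed
      ultimately have "has_inverse (of_real t - m + of_real (n - t))"
        using False t by (simp add: cpos_def del: of_real_diff)
      then show ?thesis by simp
    qed
    moreover have "has_inverse (of_real n + m)"
      using mpos n by (simp add: cpos_def add.commute)
    ultimately have "m = 0"
      unfolding n_def by (intro selfadjoint_eq_0_if_spectrum cpos_adj mpos)
    with \<open>m \<noteq> 0\<close> show False ..
  qed
  then have "adj (a * r) * (a * r) = 0"
    by (simp add: adj_mult adjs mult.assoc) (simp add: m_def h_def mult.assoc)
  then have ar: "a * r = 0" by (simp only: adj_mult_self_eq_0)
  then have aq: "a * q = a" by (simp add: qr(1) right_diff_distrib)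
  define g where "g = minv (j + of_real t)"
  have g: "g * (j + of_real t) = 1"
    unfolding g_def using jpos t by (intro minv_left) (simp add: cpos_def)
  have "h * q = (j + of_real t) * q"
    using kq by (simp add: k_def algebra_simps)
  then have "g * (h * q) = q"
    using g by (simp flip: mult.assoc)
  moreover have "h * q = h"
    by (simp add: h_def mult.assoc aq)
  ultimately have "a * (g * h) = a" using aq by simp
  then show ?thesis
    by (intro exI[of _ "g * adj a"]) (simp add: h_def mult.assoc)
qed

text \<open>A form of Kaplansky's formula: for an idempotent \<open>e\<close> this is the
  self-adjoint projection with the same kernel. Being built from \<open>e\<close>, its adjoint and
  one inverse, it is continuous at every idempotent, also along elements that are not
  idempotent.\<close>

definition rsupp :: "'a::unital_cstar_algebra \<Rightarrow> 'a"
  where "rsupp e = adj e * e * minv (1 + adj e * e - e - adj e + e * adj e)"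

text \<open>The element inverted in \<^const>\<open>rsupp\<close> is \<open>1 + (e - e\<^sup>*)\<^sup>*(e - e\<^sup>*)\<close>, and it commutes with \<open>e\<close>.\<close>

lemma idempotent_rsupp:
  fixes e :: "'a::unital_cstar_algebra"
  assumes e: "e * e = e"
  shows "has_inverse (1 + adj e * e - e - adj e + e * adj e)" (is "has_inverse ?N")
    and "adj (rsupp e) = rsupp e" "e * rsupp e = e" "rsupp e * e = rsupp e"
proof -
  have e': "adj e * adj e = adj e" by (metis adj_mult e)
  define d where "d = \<i> *\<^sub>C (e - adj e)"
  have d: "adj d = d"
    by (simp add: d_def adj_simps adj_scaleC scaleC_minus_left scaleC_diff_right)
  have "d * d = - ((e - adj e) * (e - adj e))"
    by (simp add: d_def mult_scaleC_left mult_scaleC_right scaleC_scaleC scaleC_minus_left)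
  then have dd: "d * d + of_real 1 = ?N" by (simp add: algebra_simps e e')
  show N: "has_inverse ?N"
    unfolding dd[symmetric] using cpos_square[OF d] unfolding cpos_def by (simp del: of_real_1)
  define n where "n = minv ?N"
  have n: "?N * n = 1" "n * ?N = 1" "adj n = n"
    unfolding n_def by (rule minv_right[OF N], rule minv_left[OF N], rule minv_selfadjoint[OF N])
      (simp add: adj_simps algebra_simps)
  have eN: "e * ?N = e * adj e * e" and Ne: "?N * e = e * adj e * e"
    by (simp_all add: algebra_simps e) (simp_all add: e flip: mult.assoc)
  have Ne': "?N * adj e = adj e * e * adj e" and eN': "adj e * ?N = adj e * e * adj e"
    by (simp_all add: algebra_simps e') (simp_all add: e' flip: mult.assoc)
  have ne: "n * e = e * n"
    unfolding n_def by (rule minv_commute[OF N]) (simp only: eN Ne)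
  have ne': "n * adj e = adj e * n"
    unfolding n_def by (rule minv_commute[OF N]) (simp only: eN' Ne')
  have f: "rsupp e = adj e * e * n" by (simp add: rsupp_def n_def)
  show "adj (rsupp e) = rsupp e"
    by (simp add: f adj_simps n) (metis mult.assoc ne ne')
  have "e * rsupp e = (e * adj e * e) * n" by (simp add: f mult.assoc)
  also have "\<dots> = e * (?N * n)" by (simp only: eN[symmetric] mult.assoc[of e ?N n])
  also have "\<dots> = e" by (simp only: n mult_1_right)
  finally show "e * rsupp e = e" .
  have "rsupp e * e = adj e * (e * e) * n" by (simp add: f mult.assoc ne)
  then show "rsupp e * e = rsupp e" by (simp add: e f)
qed

lemma tendsto_rsupp:
  fixes e :: "'a::unital_cstar_algebra"
  assumes "(f \<longlongrightarrow> e) F" "e * e = e"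
  shows "((\<lambda>x. rsupp (f x)) \<longlongrightarrow> rsupp e) F"
  unfolding rsupp_def
  by (intro tendsto_mult tendsto_add tendsto_diff tendsto_const tendsto_minv tendsto_adj
      assms(1) idempotent_rsupp(1) assms(2))

text \<open>Both \<open>y a\<close> and \<open>a y\<close> are idempotents. Let \<open>f\<close> be
  the projection with the kernel of \<open>y a\<close> and \<open>p\<close> the one with the range
  of \<open>a y\<close>; then \<open>m = f y p\<close> satisfies \<open>m a = f\<close> and
  \<open>a m = p\<close>. The explicit formula is what later gives continuity.\<close>

lemma moore_penrose_of_regular:
  fixes a :: "'a::unital_cstar_algebra"
  assumes a: "a * y * a = a"
  shows "moore_penrose a (rsupp (y * a) * y * rsupp (adj (a * y)))"
proof -
  have i: "(y * a) * (y * a) = y * a" "(a * y) * (a * y) = a * y"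
    using a by (metis mult.assoc)+
  then have i': "adj (a * y) * adj (a * y) = adj (a * y)" by (metis adj_mult)
  define f where "f = rsupp (y * a)"
  define p where "p = rsupp (adj (a * y))"
  have f: "adj f = f" "(y * a) * f = y * a" "f * (y * a) = f"
    unfolding f_def by (rule idempotent_rsupp[OF i(1)])+
  have p: "adj p = p" "adj (a * y) * p = adj (a * y)" "p * adj (a * y) = p"
    unfolding p_def by (rule idempotent_rsupp[OF i'])+
  have p': "p * (a * y) = a * y" "(a * y) * p = p"
    by (metis p adj_adj adj_mult)+
  have af: "a * f = a" by (metis a f(2) mult.assoc)
  have pa: "p * a = a" by (metis a p'(1) mult.assoc)
  have am: "a * (f * y * p) = p"
    using af p'(2) by (metis mult.assoc)
  have ma: "(f * y * p) * a = f"
    using pa f(3) by (metis mult.assoc)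
  have "f * f = f" by (metis af f(3) mult.assoc)
  then show ?thesis
    unfolding moore_penrose_def f_def[symmetric] p_def[symmetric] am ma
    by (simp add: pa f p flip: mult.assoc)
qed

lemma moore_penrose_gram:
  assumes "moore_penrose a m"
  shows "adj a * a * (m * adj m) = m * a" "m * adj m * (adj a * a) = m * a"
proof -
  have 1: "a * m * a = a" "m * a * m = m" and 2: "adj (a * m) = a * m" "adj (m * a) = m * a"
    using assms by (simp_all add: moore_penrose_def)
  have "m * adj m * (adj a * a) = m * adj (a * m) * a"
    by (simp add: adj_mult mult.assoc)
  then show eq: "m * adj m * (adj a * a) = m * a"
    using 1 2 by (simp add: mult.assoc)
  then have "adj (m * adj m * (adj a * a)) = m * a"
    using 2 by simp
  then show "adj a * a * (m * adj m) = m * a"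
    by (simp add: adj_simps mult.assoc)
qed

text \<open>Let \<open>g = m m^*\<close>, the inverse of \<open>h\<close> on its support
  \<open>f\<close>, and \<open>b = 1 - f\<close>. Then
  \<open>h - t = (h + b) (1 - t g) (f - t b)\<close>, and for \<open>t > 0\<close> only the middle
  factor restricts \<open>t\<close>, through \<open>t * norm g < 1\<close>. The summand 1 in the
  bound covers \<open>g = 0\<close>.\<close>

lemma moore_penrose_imp_gapped:
  fixes a :: "'a::unital_cstar_algebra"
  assumes mp: "moore_penrose a m"
  shows "gapped a"
proof -
  have 1: "a * m * a = a" "m * a * m = m" and 2: "adj (a * m) = a * m" "adj (m * a) = m * a"
    using mp by (simp_all add: moore_penrose_def)
  define h g f where "h = adj a * a" and "g = m * adj m" and "f = m * a"
  have hg: "h * g = f" "g * h = f"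
    unfolding h_def g_def f_def by (rule moore_penrose_gram[OF mp])+
  have ff: "f * f = f" by (metis 1(1) f_def mult.assoc)
  have hf: "h * f = h" by (metis 1(1) f_def h_def mult.assoc)
  have fg: "f * g = g" by (metis 1(2) f_def g_def mult.assoc)
  have "adj f = f" by (simp only: f_def 2)
  moreover have "adj g = g" by (simp add: g_def adj_mult adj_adj)
  ultimately
  have gf: "g * f = g" using adj_mult[of f g] by (simp add: fg)
  have fh: "f * h = h" by (metis hf hg mult.assoc)
  define b where "b = 1 - f"
  have b: "f * b = 0" "b * f = 0" "b * b = b" "h * b = 0" "b * h = 0" "g * b = 0" "b * g = 0" "f + b = 1"
    by (simp_all add: b_def algebra_simps ff hf fh fg gf)
  have "has_inverse (of_real t - h)" if t: "0 < t" "t < inverse (norm g + 1)" for t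
  proof -
    have H: "has_inverse (h + b)"
      by (rule has_inverseI[of _ "g + b"]) (simp_all add: distrib_left distrib_right b hg)
    have "t * norm g < 1"
    proof -
      have "t * (norm g + 1) < inverse (norm g + 1) * (norm g + 1)"
        using t by (intro mult_strict_right_mono) (auto simp: add_nonneg_pos)
      also have "\<dots> = 1" using norm_ge_zero[of g] by (intro left_inverse) linarith
      finally show ?thesis using t by (simp add: algebra_simps)
    qed
    then have G: "has_inverse (1 - t *\<^sub>R g)"
      using t by (intro has_inverse_one_minus) simp
    have B: "has_inverse (f - t *\<^sub>R b)"
      by (rule has_inverseI[of _ "f - inverse t *\<^sub>R b"])
        (use t in \<open>simp_all add: algebra_simps b ff flip: b(8)\<close>)
    have "(1 - t *\<^sub>R g) * (f - t *\<^sub>R b) = f - t *\<^sub>R g - t *\<^sub>R b"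
      by (simp add: left_diff_distrib right_diff_distrib b gf)
    moreover have "(h + b) * (f - t *\<^sub>R g - t *\<^sub>R b) = h - (t *\<^sub>R f + t *\<^sub>R b)"
      by (simp add: distrib_right right_diff_distrib b hf hg)
    moreover have "t *\<^sub>R f + t *\<^sub>R b = of_real t"
      by (simp add: b(8) of_real_def flip: scaleR_add_right)
    ultimately have "(h + b) * ((1 - t *\<^sub>R g) * (f - t *\<^sub>R b)) = h - of_real t"
      by simp
    then have "has_inverse (h - of_real t)"
      using has_inverse_mult[OF H has_inverse_mult[OF G B]] by simp
    then show ?thesis using has_inverse_minus by fastforce
  qed
  then show ?thesis
    unfolding gapped_def h_def
    by (intro exI[of _ "inverse (norm g + 1)"]) (auto simp: add_nonneg_pos)
qed

lemma gapped_iff_regular: "gapped a \<longleftrightarrow> (\<exists>y. a * y * a = a)"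
  using gapped_imp_regular moore_penrose_of_regular moore_penrose_imp_gapped by blast

section \<open>The polar decomposition\<close>

definition polar_mp :: "'a::unital_cstar_algebra \<Rightarrow> 'a \<Rightarrow> 'a"
  where "polar_mp a m = adj m * psqrt (adj a * a)"

text \<open>The first and third identities rest on \<open>m^* a^* a = (a m)^* a = a\<close>. For the
  second, \<open>m m^*\<close> commutes with \<open>a^* a\<close>, hence with its square root, so
  the two roots join to \<open>m m^* a^* a = m a\<close>.\<close>

lemma polar_mp:
  fixes a :: "'a::unital_cstar_algebra"
  assumes mp: "moore_penrose a m"
  shows "polar_mp a m * psqrt (adj a * a) = a"
    and "adj (polar_mp a m) * polar_mp a m = m * a"
    and "polar_mp a m * adj (polar_mp a m) = a * m"
proof -
  have 1: "a * m * a = a" "m * a * m = m" and 2: "adj (a * m) = a * m" "adj (m * a) = m * a"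
    using mp by (simp_all add: moore_penrose_def)
  define h where "h = adj a * a"
  have h: "cpos h" unfolding h_def by (rule cpos_adj_mult_self)
  define b where "b = psqrt h"
  have b: "b * b = h" "adj b = b"
    unfolding b_def by (rule psqrt_square[OF h], rule cpos_adj[OF cpos_psqrt[OF h]])
  have u: "polar_mp a m = adj m * b" by (simp add: polar_mp_def b_def h_def)

  have mh: "adj m * h = a"
  proof -
    have "adj m * h = adj (a * m) * a" by (simp add: h_def adj_mult mult.assoc)
    then show ?thesis using 1 2 by simp
  qed
  show "polar_mp a m * psqrt (adj a * a) = a"
    using mh by (simp add: u mult.assoc b flip: h_def b_def)
  have gb: "m * adj m * b = b * (m * adj m)"
    unfolding b_def by (rule psqrt_commute[OF h]) (simp add: h_def moore_penrose_gram[OF mp])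
  have "b * (m * adj m) * b = m * adj m * (b * b)"
    by (simp add: mult.assoc flip: gb)
  then show "adj (polar_mp a m) * polar_mp a m = m * a"
    using moore_penrose_gram(2)[OF mp] by (simp add: u adj_simps b mult.assoc h_def)
  have "polar_mp a m * adj (polar_mp a m) = (adj m * h) * m"
    by (simp add: u adj_simps b mult.assoc flip: b(1))
  then show "polar_mp a m * adj (polar_mp a m) = a * m"
    by (simp add: mh)
qed

text \<open>The left supports of \<open>a\<close> and \<open>x\<close> are orthogonal, and so are
  the right ones; all mixed products vanish, the moduli add to \<open>|a| + t |x|\<close>, and the
  factor \<open>t\<close> cancels against \<open>inverse t\<close> in the Moore-Penrose
  inverse.\<close>

lemma polar_mp_orthogonal_sum:
  fixes a x :: "'a::unital_cstar_algebra"
  assumes am: "moore_penrose a m" and xn: "moore_penrose x n"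
    and orth: "a * m * x = 0" "x * (m * a) = 0" and t: "t > 0"
  shows "moore_penrose (a + t *\<^sub>R x) (m + inverse t *\<^sub>R n)"
    and "polar_mp (a + t *\<^sub>R x) (m + inverse t *\<^sub>R n) = polar_mp a m + polar_mp x n"
proof -
  have a: "a * m * a = a" "m * a * m = m" "adj (a * m) = a * m" "adj (m * a) = m * a"
    using am by (simp_all add: moore_penrose_def)
  have x: "x * n * x = x" "n * x * n = n" "adj (x * n) = x * n" "adj (n * x) = n * x"
    using xn by (simp_all add: moore_penrose_def)
  have "adj a = adj a * (a * m)" by (metis a(1,3) adj_mult mult.assoc)
  then have ax: "adj a * x = 0" using orth(1) by (metis mult.assoc mult_zero_right)
  then have xa: "adj x * a = 0" by (metis adj_adj adj_mult adj_zero)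
  have "adj a = m * a * adj a" by (metis a(1,4) adj_mult mult.assoc)
  then have xa': "x * adj a = 0" using orth(2) by (metis mult.assoc mult_zero_left)
  then have ax': "a * adj x = 0" by (metis adj_adj adj_mult adj_zero)
  have xm: "x * m = 0" using orth(2) a(2) by (metis mult.assoc mult_zero_left)
  have mx: "m * x = 0" using orth(1) a(2) by (metis mult.assoc mult_zero_right)
  have "n = adj x * adj n * n" by (metis x(2,4) adj_mult)
  then have an: "a * n = 0" using ax' by (metis mult.assoc mult_zero_left)
  have "n = n * (adj n * adj x)" by (metis x(2,3) adj_mult mult.assoc)
  then have na: "n * a = 0" using xa by (metis mult.assoc mult_zero_right)
  have sm: "(a + t *\<^sub>R x) * (m + inverse t *\<^sub>R n) = a * m + x * n"
    "(m + inverse t *\<^sub>R n) * (a + t *\<^sub>R x) = m * a + n * x"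
    using t by (simp_all add: distrib_left distrib_right xm mx an na)
  show "moore_penrose (a + t *\<^sub>R x) (m + inverse t *\<^sub>R n)"
    unfolding moore_penrose_def sm
    by (simp add: distrib_left distrib_right adj_add a x)
      (simp add: mult.assoc mx na xm an)
  define b where "b = psqrt (adj a * a)"
  define c where "c = psqrt (adj x * x)"
  have ha: "cpos (adj a * a)" and hx: "cpos (adj x * x)" by (rule cpos_adj_mult_self)+
  have b: "cpos b" "b * b = adj a * a" and c: "cpos c" "c * c = adj x * x"
    unfolding b_def c_def by (rule cpos_psqrt psqrt_square ha hx)+
  have hh: "(adj x * x) * (adj a * a) = 0" "(adj a * a) * (adj x * x) = 0"
    by (metis ax' xa' mult.assoc mult_zero_left mult_zero_right)+
  have "(adj x * x) * b = b * (adj x * x)"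
    unfolding b_def by (rule psqrt_commute[OF ha]) (simp only: hh)
  then have bc: "b * c = c * b"
    unfolding c_def by (intro psqrt_commute[OF hx]) (rule sym)
  have "(b * c) * (b * c) = (b * b) * (c * c)"
    by (metis bc mult.assoc)
  then have "(b * c) * (b * c) = 0" by (simp add: b c hh)
  moreover have "adj (b * c) = b * c"
    using b(1) c(1) by (simp add: adj_mult cpos_adj bc)
  ultimately have bc0: "b * c = 0" by (rule selfadjoint_square_eq_0[rotated])
  have sq: "psqrt (adj (a + t *\<^sub>R x) * (a + t *\<^sub>R x)) = b + t *\<^sub>R c"
  proof (rule psqrt_eqI)
    show "cpos (b + t *\<^sub>R c)" using b c t by (intro cpos_add cpos_scaleR) auto
    show "(b + t *\<^sub>R c) * (b + t *\<^sub>R c) = adj (a + t *\<^sub>R x) * (a + t *\<^sub>R x)"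
      using bc bc0 by (simp add: distrib_left distrib_right b c adj_simps ax xa)
  qed
  \<comment> \<open>The C*-identity reduces a mixed term with the modulus \<open>c\<close> to one
    with \<open>c * c = adj x * x\<close>, where \<open>x * m = 0\<close> applies.\<close>
  have "adj (adj (adj m * c)) * adj (adj m * c) = adj m * (adj x * (x * m))"
    using c by (simp add: adj_simps cpos_adj) (metis mult.assoc)
  then have mc: "adj m * c = 0"
    using adj_mult_self_eq_0[of "adj (adj m * c)"] adj_adj[of "adj m * c"] by (simp add: xm)
  have "adj (adj (adj n * b)) * adj (adj n * b) = adj n * (adj a * (a * n))"
    using b by (simp add: adj_simps cpos_adj) (metis mult.assoc)
  then have nb: "adj n * b = 0"
    using adj_mult_self_eq_0[of "adj (adj n * b)"] adj_adj[of "adj n * b"] by (simp add: an)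
  show "polar_mp (a + t *\<^sub>R x) (m + inverse t *\<^sub>R n) = polar_mp a m + polar_mp x n"
    unfolding polar_mp_def sq using t
    by (simp add: adj_simps distrib_left distrib_right mc nb flip: b_def c_def)
qed

section \<open>Perturbation of the Moore--Penrose inverse\<close>

text \<open>For \<open>b\<close> near \<open>a\<close> an outer inverse of \<open>b\<close>, equal
  to \<open>m\<close> at \<open>b = a\<close>. In general it is not an inner inverse, and
  \<open>b - b G b\<close> measures the failure.\<close>

definition perturbed_inverse :: "'a::unital_cstar_algebra \<Rightarrow> 'a \<Rightarrow> 'a \<Rightarrow> 'a"
  where "perturbed_inverse a m b = minv (1 + m * (b - a)) * m"

text \<open>\<open>G\<close> inverts the part of \<open>b\<close> close to \<open>a\<close>; the remainder \<open>b - b G b\<close>, a Schur complement, lives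
  in the corner cut out by the defect projections of \<open>a\<close>, and inherits regularity from \<open>b\<close>.\<close>

lemma perturbed_inverse:
  fixes a b :: "'a::unital_cstar_algebra"
  assumes mp: "moore_penrose a m"
    and inv: "has_inverse (1 + m * (b - a))" "has_inverse (1 + (b - a) * m)"
  defines "G \<equiv> perturbed_inverse a m b"
  shows "(1 - a * m) * (b - b * G * b) * (1 - m * a) = b - b * G * b"
    and "b * y * b = b \<Longrightarrow> (b - b * G * b) * y * (b - b * G * b) = b - b * G * b"
proof -
  have a: "a * m * a = a" "m * a * m = m"
    using mp by (simp_all add: moore_penrose_def)
  define p q k l where "p = a * m" and "q = m * a" and "k = 1 + m * (b - a)" and "l = 1 + (b - a) * m"
  have pq: "m * p = m" "q * m = m" "q * q = q" "p * p = p"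
    using a by (simp_all add: p_def q_def mult.assoc)
  have k: "k * minv k = 1" "minv k * k = 1" and l: "l * minv l = 1" "minv l * l = 1"
    using inv by (simp_all add: k_def l_def minv_left minv_right)
  have G: "G = minv k * m" by (simp add: G_def perturbed_inverse_def k_def)
  have "m * b * q = k * q"
    using pq by (simp add: k_def algebra_simps flip: q_def)
  then have Gbq: "G * b * q = q"
    using k by (metis G mult.assoc mult_1_left)
  \<comment> \<open>This gives the second form \<open>G = m * minv l\<close>. The first form yields
    \<open>G b q = q\<close>, the second \<open>p b G = p\<close>; together they put the Schur
    complement into the corner.\<close>
  have "k * m = m * l"
    by (simp add: k_def l_def algebra_simps)
  then have G': "G = m * minv l"
    using k l by (metis G mult.assoc mult_1_left mult_1_right)
  have "p * b * m = p * l"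
    using pq by (simp add: l_def algebra_simps flip: p_def)
  then have pbG: "p * b * G = p"
    using l by (metis G' mult.assoc mult_1_right)
  have "G * p = G" by (simp add: G mult.assoc pq)
  then have GbG: "G * b * G = G"
    using pbG by (metis mult.assoc)
  define s where "s = b - b * G * b"
  have ps: "p * s = 0"
    using pbG by (simp add: s_def right_diff_distrib flip: mult.assoc)
  have sq: "s * q = 0"
    using Gbq by (simp add: s_def left_diff_distrib mult.assoc)
  show "(1 - a * m) * (b - b * G * b) * (1 - m * a) = b - b * G * b"
    unfolding s_def[symmetric] p_def[symmetric] q_def[symmetric]
    by (simp add: left_diff_distrib right_diff_distrib ps sq)
  show "(b - b * G * b) * y * (b - b * G * b) = b - b * G * b" if y: "b * y * b = b"
  proof -
    \<comment> \<open>As \<open>s = (1 - b G) b = b (1 - G b)\<close>, the product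
      \<open>b y b\<close> appears in the middle and collapses to \<open>b\<close>.\<close>
    have "s * y * s = (1 - b * G) * (b * y * b) * (1 - G * b)"
      by (simp add: s_def algebra_simps)
    also have "\<dots> = b - b * G * b - b * G * b + b * (G * b * G) * b"
      unfolding y by (simp add: algebra_simps)
    finally show ?thesis
      unfolding GbG by (simp add: s_def)
  qed
qed

lemma tendsto_perturbed_inverse:
  fixes a :: "'a::unital_cstar_algebra"
  assumes "(f \<longlongrightarrow> a) F"
  shows "((\<lambda>x. perturbed_inverse a m (f x)) \<longlongrightarrow> m) F"
proof -
  have "((\<lambda>x. minv (1 + m * (f x - a)) * m) \<longlongrightarrow> minv (1 + m * (a - a)) * m) F"
    by (intro tendsto_mult tendsto_add tendsto_diff tendsto_const tendsto_minv assms)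
      (simp add: has_inverseI[of 1 1])
  then show ?thesis
    using minv_eq[of "1::'a" 1] by (simp add: perturbed_inverse_def)
qed

section \<open>The unitization as a unital C*-algebra\<close>

text \<open>A unitization element acts on the algebra by left multiplication. If the algebra has a unit
  this action is not faithful, and the maximum with the modulus of the scalar part repairs the
  norm; otherwise the operator norm alone already dominates that modulus.\<close>

definition left_action :: "'a::cstar_algebra unitization \<Rightarrow> 'a \<Rightarrow> 'a"
  where "left_action X y = upart X * y + ucoeff X *\<^sub>C y"

lemma bounded_linear_scaleC_right: "bounded_linear (\<lambda>y::'a::cstar_algebra. c *\<^sub>C y)"
  by (rule bounded_linear_intro[where K = "cmod c"])
    (simp_all add: scaleC_add_right norm_scaleC scaleR_eq_scaleC scaleC_scaleC mult.commute)

lemma bounded_linear_left_action: "bounded_linear (left_action X)"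
proof -
  have "bounded_linear (\<lambda>y. upart X * y + ucoeff X *\<^sub>C y)"
    by (intro bounded_linear_add bounded_linear_mult_right bounded_linear_scaleC_right)
  then show ?thesis by (simp add: left_action_def[abs_def])
qed

lemma upart_ucoeff_simps [simp]:
  "upart (X + Y) = upart X + upart Y" "ucoeff (X + Y) = ucoeff X + ucoeff Y"
  "upart (X - Y) = upart X - upart Y" "ucoeff (X - Y) = ucoeff X - ucoeff Y"
  "upart (- X) = - upart X" "ucoeff (- X) = - ucoeff X"
  "upart 0 = 0" "ucoeff 0 = 0" "upart 1 = 0" "ucoeff 1 = 1"
  "upart (c *\<^sub>C X) = c *\<^sub>C upart X" "ucoeff (c *\<^sub>C X) = c * ucoeff X"
  "upart (X * Y) = upart X * upart Y + ucoeff X *\<^sub>C upart Y + ucoeff Y *\<^sub>C upart X"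
  "ucoeff (X * Y) = ucoeff X * ucoeff Y"
  for X Y :: "'a::cstar_algebra unitization"
  by (simp_all add: plus_unitization_def minus_unitization_def uminus_unitization_def
      zero_unitization_def one_unitization_def scaleC_unitization_def times_unitization_def)

lemma left_action_simps:
  "left_action (X + Y) = (\<lambda>y. left_action X y + left_action Y y)"
  "left_action (X * Y) = left_action X \<circ> left_action Y"
  "left_action (c *\<^sub>C X) = (\<lambda>y. c *\<^sub>C left_action X y)"
  by (auto simp: fun_eq_iff left_action_def algebra_simps scaleC_add_left scaleC_add_right scaleC_scaleC
      mult_scaleC_left mult_scaleC_right)

text \<open>Left multiplication by \<open>x\<close> is tested on \<open>adj x\<close>, where the
  C*-identity gives the square of \<open>norm x\<close>. This makes the embedding isometric.\<close>

lemma onorm_left_action_upart: "norm x \<le> onorm (left_action (Unitize x 0))"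
proof (cases "x = 0")
  case False
  have "norm (x * adj x) \<le> onorm (left_action (Unitize x 0)) * norm (adj x)"
    using onorm[OF bounded_linear_left_action[of "Unitize x 0"], of "adj x"]
    by (simp add: left_action_def)
  then have "norm x * norm x \<le> onorm (left_action (Unitize x 0)) * norm x"
    using cstar_identity[of "adj x"] by (simp add: adj_adj power2_eq_square)
  then show ?thesis
    using False by simp
qed (simp add: onorm_pos_le bounded_linear_left_action)

instantiation unitization :: (cstar_algebra) real_normed_algebra_1
begin

definition "r *\<^sub>R x = complex_of_real r *\<^sub>C (x :: 'a unitization)"
definition "norm x = max (cmod (ucoeff x)) (onorm (left_action (x :: 'a unitization)))"
definition "dist x y = norm (x - (y :: 'a unitization))"
definition "sgn x = inverse (norm x) *\<^sub>R (x :: 'a unitization)"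
definition "uniformity =
  (INF e\<in>{0<..}. principal {(x, y :: 'a unitization). dist x y < e})"
definition "open U \<longleftrightarrow>
  (\<forall>x\<in>U. \<forall>\<^sub>F (x', y) in uniformity. x' = x \<longrightarrow> (y :: 'a unitization) \<in> U)"

instance
proof
  fix x y :: "'a unitization" and a b :: real and U :: "'a unitization set"
  show "a *\<^sub>R (x + y) = a *\<^sub>R x + a *\<^sub>R y" "(a + b) *\<^sub>R x = a *\<^sub>R x + b *\<^sub>R x"
    "a *\<^sub>R b *\<^sub>R x = (a * b) *\<^sub>R x" "1 *\<^sub>R x = x"
    "a *\<^sub>R x * y = a *\<^sub>R (x * y)" "x * a *\<^sub>R y = a *\<^sub>R (x * y)"
    by (auto simp: scaleR_unitization_def unitization.expand algebra_simps scaleC_add_right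
        scaleC_add_left scaleC_scaleC mult_scaleC_left mult_scaleC_right
        intro!: unitization.expand)
  show "dist x y = norm (x - y)" "sgn x = inverse (norm x) *\<^sub>R x"
    "uniformity = (INF e\<in>{0<..}. principal {(x, y :: 'a unitization). dist x y < e})"
    "open U \<longleftrightarrow> (\<forall>x\<in>U. \<forall>\<^sub>F (x', y) in uniformity. x' = x \<longrightarrow> y \<in> U)"
    by (simp_all only: dist_unitization_def sgn_unitization_def uniformity_unitization_def
        open_unitization_def)
  note bl = bounded_linear_left_action
  have zero: "left_action 0 = (\<lambda>y::'a. 0)" by (simp add: fun_eq_iff left_action_def)
  show "norm x = 0 \<longleftrightarrow> x = 0"
  proof
    assume "norm x = 0"
    then have "cmod (ucoeff x) \<le> 0" "onorm (left_action x) \<le> 0"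
      unfolding norm_unitization_def by (metis max.cobounded1, metis max.cobounded2)
    then have "ucoeff x = 0" by simp
    moreover have "norm (upart x) \<le> 0"
      using onorm_left_action_upart[of "upart x"] \<open>onorm (left_action x) \<le> 0\<close> \<open>ucoeff x = 0\<close>
      by (metis order_trans unitization.collapse)
    ultimately show "x = 0" by (simp add: unitization.expand)
  qed (simp add: norm_unitization_def zero onorm_zero)
  have "onorm (left_action (x + y)) \<le> onorm (left_action x) + onorm (left_action y)"
    unfolding left_action_simps by (intro onorm_triangle bl)
  then show "norm (x + y) \<le> norm x + norm y"
    using norm_triangle_ineq[of "ucoeff x" "ucoeff y"] by (simp add: norm_unitization_def max_def)
  have "onorm (left_action (a *\<^sub>R x)) = \<bar>a\<bar> * onorm (left_action x)"
    unfolding scaleR_unitization_def left_action_simps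
    using onorm_scaleR[OF bl[of x], of a] by (simp add: scaleR_eq_scaleC)
  then show "norm (a *\<^sub>R x) = \<bar>a\<bar> * norm x"
    by (simp add: norm_unitization_def scaleR_unitization_def norm_mult max_mult_distrib_left)
  have "onorm (left_action (x * y)) \<le> onorm (left_action x) * onorm (left_action y)"
    unfolding left_action_simps by (intro onorm_compose bl)
  also have "\<dots> \<le> norm x * norm y"
    by (intro mult_mono) (auto simp: norm_unitization_def onorm_pos_le bl le_max_iff_disj)
  finally have "onorm (left_action (x * y)) \<le> norm x * norm y" .
  moreover have "cmod (ucoeff (x * y)) \<le> norm x * norm y"
    unfolding upart_ucoeff_simps norm_mult by (intro mult_mono) (auto simp: norm_unitization_def le_max_iff_disj)
  ultimately show "norm (x * y) \<le> norm x * norm y"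
    by (simp add: norm_unitization_def[of "x * y"])
  have "onorm (left_action (1 :: 'a unitization)) \<le> 1"
    by (rule onorm_bound) (simp_all add: left_action_def)
  then show "norm (1 :: 'a unitization) = 1"
    by (simp add: norm_unitization_def)
qed

end

lemma cmod_ucoeff_le: "cmod (ucoeff X) \<le> norm X"
  by (simp add: norm_unitization_def)

lemma norm_Unitize_le: "norm (Unitize x c) \<le> norm x + cmod c"
proof -
  have "onorm (left_action (Unitize x c)) \<le> norm x + cmod c"
  proof (rule onorm_bound)
    fix y
    have "norm (x * y + c *\<^sub>C y) \<le> norm x * norm y + cmod c * norm y"
      by (rule norm_triangle_mono) (simp_all add: norm_mult_ineq norm_scaleC)
    then show "norm (left_action (Unitize x c) y) \<le> (norm x + cmod c) * norm y"
      by (simp add: left_action_def distrib_right)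
  qed simp
  then show ?thesis by (simp add: norm_unitization_def)
qed

lemma norm_unitize [simp]: "norm (unitize x) = norm x"
  using onorm_left_action_upart[of x] norm_Unitize_le[of x 0]
  by (simp add: unitize_def norm_unitization_def)

text \<open>Removing the scalar part costs at most another \<open>norm X\<close>, whence the 2.
  Continuity of the coordinates gives completeness, and later brings limits back from the
  unitization to the algebra.\<close>

lemma norm_upart_le: "norm (upart X) \<le> 2 * norm X"
proof -
  have "unitize (upart X) = X - ucoeff X *\<^sub>C 1"
    by (rule unitization.expand) (simp add: unitize_def)
  then have "norm (upart X) \<le> norm X + norm (ucoeff X *\<^sub>C (1::'a unitization))"
    by (metis norm_unitize norm_triangle_ineq4)
  also have "ucoeff X *\<^sub>C (1::'a unitization) = Unitize 0 (ucoeff X)"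
    by (rule unitization.expand) simp
  also have "norm X + norm (Unitize (0::'a) (ucoeff X)) \<le> norm X + norm X"
    using norm_Unitize_le[of "0::'a" "ucoeff X"] cmod_ucoeff_le[of X] by simp
  finally show ?thesis by simp
qed

lemma bounded_linear_upart: "bounded_linear (upart :: 'a::cstar_algebra unitization \<Rightarrow> 'a)"
  by (rule bounded_linear_intro[where K = 2])
    (use norm_upart_le in \<open>simp_all add: scaleR_unitization_def scaleR_eq_scaleC mult.commute\<close>)

lemma bounded_linear_ucoeff: "bounded_linear (ucoeff :: 'a::cstar_algebra unitization \<Rightarrow> complex)"
  by (rule bounded_linear_intro[where K = 1])
    (use cmod_ucoeff_le in \<open>simp_all add: scaleR_unitization_def scaleR_conv_of_real\<close>)

instance unitization :: (cstar_algebra) banach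
proof
  fix X :: "nat \<Rightarrow> 'a unitization"
  assume X: "Cauchy X"
  have "Cauchy (\<lambda>n. upart (X n))" "Cauchy (\<lambda>n. ucoeff (X n))"
    by (rule bounded_linear.Cauchy[OF bounded_linear_upart X]
        bounded_linear.Cauchy[OF bounded_linear_ucoeff X])+
  then obtain x c where x: "(\<lambda>n. upart (X n)) \<longlonglongrightarrow> x" and c: "(\<lambda>n. ucoeff (X n)) \<longlonglongrightarrow> c"
    by (meson Cauchy_convergent convergent_def)
  have "X \<longlonglongrightarrow> Unitize x c"
    unfolding LIM_zero_iff[symmetric, of X]
  proof (rule Lim_null_comparison)
    have "norm (X n - Unitize x c) \<le> norm (upart (X n) - x) + cmod (ucoeff (X n) - c)" for n
      using norm_Unitize_le[of "upart (X n - Unitize x c)" "ucoeff (X n - Unitize x c)"]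
      unfolding unitization.collapse by simp
    then show "\<forall>\<^sub>F n in sequentially. norm (X n - Unitize x c)
        \<le> norm (upart (X n) - x) + cmod (ucoeff (X n) - c)"
      by simp
    show "(\<lambda>n. norm (upart (X n) - x) + cmod (ucoeff (X n) - c)) \<longlonglongrightarrow> 0"
      by (intro tendsto_add_zero tendsto_norm_zero LIM_zero x c)
  qed
  then show "convergent X" by (auto simp: convergent_def)
qed

instantiation unitization :: (cstar_algebra) unital_cstar_algebra
begin

definition "adj X = Unitize (adj (upart X)) (cnj (ucoeff (X :: 'a unitization)))"

instance
proof
  fix x y :: "'a unitization" and c d :: complex and r :: real
  have sel: "upart (adj z) = adj (upart z)" "ucoeff (adj z) = cnj (ucoeff z)" for z :: "'a unitization"
    by (simp_all add: adj_unitization_def)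
  show "r *\<^sub>R x = complex_of_real r *\<^sub>C x" by (rule scaleR_unitization_def)
  show "c *\<^sub>C (x + y) = c *\<^sub>C x + c *\<^sub>C y" "(c + d) *\<^sub>C x = c *\<^sub>C x + d *\<^sub>C x"
    "c *\<^sub>C d *\<^sub>C x = (c * d) *\<^sub>C x" "(c *\<^sub>C x) * y = c *\<^sub>C (x * y)" "x * (c *\<^sub>C y) = c *\<^sub>C (x * y)"
    by (auto simp: algebra_simps scaleC_add_right
        scaleC_add_left scaleC_scaleC mult_scaleC_left mult_scaleC_right
        intro!: unitization.expand)
  show "adj (adj x) = x" "adj (x + y) = adj x + adj y" "adj (c *\<^sub>C x) = cnj c *\<^sub>C adj x"
    by (auto simp: sel adj_adj adj_add adj_scaleC intro!: unitization.expand)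
  have am: "adj (x * y) = adj y * adj x" for x y :: "'a unitization"
    by (auto simp: sel adj_mult adj_add adj_scaleC add_ac intro!: unitization.expand)
  show "adj (x * y) = adj y * adj x" by (rule am)
  note bl = bounded_linear_left_action
  have scale: "onorm (left_action (c *\<^sub>C x)) = cmod c * onorm (left_action x)" if "c \<noteq> 0" for c and x :: "'a unitization"
  proof -
    have le: "onorm (left_action (c *\<^sub>C x)) \<le> cmod c * onorm (left_action x)" for c and x :: "'a unitization"
    proof (rule onorm_bound)
      fix y show "norm (left_action (c *\<^sub>C x) y) \<le> cmod c * onorm (left_action x) * norm y"
        using onorm[OF bl[of x], of y]
        by (simp add: left_action_simps norm_scaleC mult.assoc mult_left_mono)
    qed (simp add: onorm_pos_le bl)
    have "onorm (left_action (inverse c *\<^sub>C c *\<^sub>C x)) \<le> cmod (inverse c) * onorm (left_action (c *\<^sub>C x))"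
      by (rule le)
    moreover have "inverse c *\<^sub>C c *\<^sub>C x = x"
      using that by (intro unitization.expand) (simp add: scaleC_scaleC)
    ultimately show ?thesis
      using le[of c x] that by (simp add: norm_divide field_simps)
  qed
  show "norm (c *\<^sub>C x) = cmod c * norm x"
  proof (cases "c = 0")
    case True
    then have "c *\<^sub>C x = 0" by (intro unitization.expand) simp
    with True show ?thesis by simp
  next
    case False
    then show ?thesis
      by (simp add: norm_unitization_def scale norm_mult max_mult_distrib_left)
  qed
  have pos: "0 \<le> onorm (left_action z)" for z :: "'a unitization" by (rule onorm_pos_le[OF bl])
  \<comment> \<open>Applying the C*-identity of the algebra to \<open>left_action z y\<close> moves
    \<open>adj z\<close> across and leaves \<open>adj y\<close> times the action of
    \<open>adj z * z\<close> on \<open>y\<close>.\<close>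
  have sq: "(onorm (left_action z))\<^sup>2 \<le> onorm (left_action (adj z * z))" for z :: "'a unitization"
  proof -
    have "onorm (left_action z) \<le> sqrt (onorm (left_action (adj z * z)))"
    proof (rule onorm_bound)
      fix y
      have "adj (left_action z y) * left_action z y = adj y * left_action (adj z * z) y"
        by (simp add: left_action_def sel adj_add adj_mult adj_scaleC algebra_simps scaleC_add_right
            scaleC_add_left scaleC_scaleC mult_scaleC_left mult_scaleC_right)
      then have "(norm (left_action z y))\<^sup>2 = norm (adj y * left_action (adj z * z) y)"
        by (metis cstar_identity)
      also have "\<dots> \<le> norm y * (onorm (left_action (adj z * z)) * norm y)"
        by (rule order_trans[OF norm_mult_ineq]) (simp add: mult_left_mono onorm[OF bl])
      also have "\<dots> = (sqrt (onorm (left_action (adj z * z))) * norm y)\<^sup>2"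
        by (simp add: power_mult_distrib power2_eq_square pos)
      finally show "norm (left_action z y) \<le> sqrt (onorm (left_action (adj z * z))) * norm y"
        by (rule power2_le_imp_le) (simp add: pos)
    qed (simp add: pos)
    then have "(onorm (left_action z))\<^sup>2 \<le> (sqrt (onorm (left_action (adj z * z))))\<^sup>2"
      by (intro power_mono pos)
    then show ?thesis by (simp add: pos)
  qed
  have mult: "onorm (left_action (z * w)) \<le> onorm (left_action z) * onorm (left_action w)" for z w :: "'a unitization"
    unfolding left_action_simps by (intro onorm_compose bl)
  have le: "onorm (left_action z) \<le> onorm (left_action (adj z))" for z :: "'a unitization"
    using order_trans[OF sq mult, of z] pos[of z] pos[of "adj z"]
    by (cases "onorm (left_action z) = 0") (auto simp: power2_eq_square)
  have "onorm (left_action (adj x)) = onorm (left_action x)"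
    using le[of x] le[of "adj x"] \<open>adj (adj x) = x\<close> by simp
  then have op: "onorm (left_action (adj x * x)) = (onorm (left_action x))\<^sup>2"
    using sq[of x] mult[of "adj x" x] by (simp add: power2_eq_square)
  have co: "cmod (ucoeff (adj x * x)) = (cmod (ucoeff x))\<^sup>2"
    by (simp add: sel norm_mult power2_eq_square)
  \<comment> \<open>Operator norm and modulus of the scalar part satisfy the C*-identity separately,
    so their maximum does too.\<close>
  show "norm (adj x * x) = (norm x)\<^sup>2"
    unfolding norm_unitization_def op co
    using pos[of x] by (auto simp: max_def power_mono not_le intro: antisym dest: power2_le_imp_le)
qed

end

section \<open>The algebra as an ideal of its unitization\<close>

lemma unitize_inject: "unitize x = unitize y \<longleftrightarrow> x = y"
  by (simp add: unitize_def)

lemma unitize_simps: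
  "unitize (x + y) = unitize x + unitize y" "unitize (x - y) = unitize x - unitize y"
  "unitize (x * y) = unitize x * unitize y" "unitize (c *\<^sub>C x) = c *\<^sub>C unitize x"
  "unitize (adj x) = adj (unitize x)" "unitize 0 = 0" "unitize (r *\<^sub>R x) = r *\<^sub>R unitize x"
  by (auto simp: unitize_def adj_unitization_def scaleR_unitization_def scaleR_eq_scaleC
      intro!: unitization.expand)

lemma upart_unitize [simp]: "upart (unitize x) = x" "ucoeff (unitize x) = 0"
  by (simp_all add: unitize_def)

lemma unitize_upart: "ucoeff X = 0 \<Longrightarrow> unitize (upart X) = X"
  by (rule unitization.expand) simp

lemma bounded_linear_unitize: "bounded_linear (unitize :: 'a::cstar_algebra \<Rightarrow> 'a unitization)"
  by (rule bounded_linear_intro[where K = 1]) (simp_all add: unitize_simps)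

section \<open>Transfer between an algebra and its unitization\<close>

lemma ambient_one_unital:
  assumes "is_identity (e::'a::cstar_algebra)"
  shows "ambient_one = unitize e" "ambient = range (unitize :: 'a \<Rightarrow> _)"
proof -
  have "(THE e::'a. is_identity e) = e"
    using assms by (intro the_equality) (metis is_identity_def)+
  then show "ambient_one = unitize e" using assms by (auto simp: ambient_one_def)
  show "ambient = range (unitize :: 'a \<Rightarrow> _)" using assms by (auto simp: ambient_def)
qed

lemma ambient_one_mult: "ambient_one * unitize x = unitize x" "unitize x * ambient_one = unitize x"
proof -
  have "ambient_one * unitize x = unitize x \<and> unitize x * ambient_one = unitize x"
  proof (cases "\<exists>e::'a. is_identity e")
    case True
    then obtain e :: 'a where e: "is_identity e" by blast
    then show ?thesis
      unfolding ambient_one_unital(1)[OF e] by (simp add: is_identity_def flip: unitize_simps)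
  next
    case False
    then show ?thesis by (simp add: ambient_one_def)
  qed
  then show "ambient_one * unitize x = unitize x" "unitize x * ambient_one = unitize x" by auto
qed

text \<open>If the algebra has a unit \<open>E\<close>, the unitization splits along
  \<open>E\<close> and \<open>1 - E\<close>. On the second summand \<open>c - x\<close> acts as the
  scalar \<open>c\<close>, which is invertible precisely for \<open>c \<noteq> 0\<close>.\<close>

lemma cstar_spectrum_iff:
  fixes x :: "'a::cstar_algebra"
  assumes c: "c \<noteq> 0"
  shows "c \<in> cstar_spectrum x \<longleftrightarrow> \<not> has_inverse (c *\<^sub>C 1 - unitize x)"
proof (cases "\<exists>e::'a. is_identity e")
  case False
  then show ?thesis
    by (simp add: cstar_spectrum_def ambient_def ambient_one_def has_inverse_def)
next
  case True
  then obtain e :: 'a where e: "is_identity e" by blast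
  have ex: "e * y = y" "y * e = y" for y using e by (simp_all add: is_identity_def)
  define E where "E = unitize e"
  have E: "E * unitize y = unitize y" "unitize y * E = unitize y" for y
    unfolding E_def by (simp_all add: ex flip: unitize_simps)
  have EE: "E * E = E" using E[of e] by (simp add: E_def)
  have EX: "E * Z = unitize (upart (E * Z))" for Z
    by (rule unitize_upart[symmetric]) (simp add: E_def)
  have Ecent: "E * Z = Z * E" for Z
    by (rule unitization.expand) (simp add: E_def ex)
  have iff: "c \<in> cstar_spectrum x \<longleftrightarrow>
      \<not> (\<exists>y. (c *\<^sub>C E - unitize x) * unitize y = E \<and> unitize y * (c *\<^sub>C E - unitize x) = E)"
    by (auto simp: cstar_spectrum_def ambient_one_unital[OF e] E_def)
  have dec: "c *\<^sub>C 1 - unitize x = (c *\<^sub>C E - unitize x) + c *\<^sub>C (1 - E)"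
    by (simp add: scaleC_diff_right)
  define d where "d = c *\<^sub>C E - unitize x"
  have dE: "d * E = d" "E * d = d"
    by (simp_all add: d_def left_diff_distrib right_diff_distrib mult_scaleC_left mult_scaleC_right E EE)
  have "(\<exists>y. d * unitize y = E \<and> unitize y * d = E) \<longleftrightarrow> has_inverse (d + c *\<^sub>C (1 - E))"
  proof
    assume "\<exists>y. d * unitize y = E \<and> unitize y * d = E"
    then obtain y where y: "d * unitize y = E" "unitize y * d = E" by blast
    show "has_inverse (d + c *\<^sub>C (1 - E))"
      by (rule has_inverseI[of _ "unitize y + inverse c *\<^sub>C (1 - E)"])
        (use c in \<open>simp_all add: distrib_left distrib_right left_diff_distrib right_diff_distrib
          mult_scaleC_left mult_scaleC_right scaleC_scaleC y dE E EE\<close>)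
  next
    assume "has_inverse (d + c *\<^sub>C (1 - E))"
    then obtain w where w: "(d + c *\<^sub>C (1 - E)) * w = 1" "w * (d + c *\<^sub>C (1 - E)) = 1"
      unfolding has_inverse_def by blast
    have E0: "E * (1 - E) = 0" "(1 - E) * E = 0" by (simp_all add: algebra_simps EE)
    have "E * ((d + c *\<^sub>C (1 - E)) * w) = d * w"
      by (simp add: distrib_left distrib_right dE E0 mult_scaleC_right flip: mult.assoc)
    then have 1: "d * w = E" by (simp add: w)
    have "(w * (d + c *\<^sub>C (1 - E))) * E = w * d"
      by (simp add: distrib_left distrib_right dE E0 mult_scaleC_left mult.assoc)
    then have 2: "w * d = E" by (simp add: w)
    have "d * (E * w) = E" "(E * w) * d = E"
      using 1 2 by (metis dE mult.assoc, metis EE mult.assoc)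
    then show "\<exists>y. d * unitize y = E \<and> unitize y * d = E"
      using EX[of w] by metis
  qed
  then show ?thesis unfolding iff dec d_def[symmetric] by blast
qed

text \<open>The interval in \<open>closed_range\<close> omits 0, and away from 0 the spectrum can be
  computed in the unitization whether or not the algebra has a unit.\<close>

lemma closed_range_iff_gapped: "closed_range a \<longleftrightarrow> gapped (unitize a)"
proof -
  have spec: "complex_of_real t \<in> cstar_spectrum (adj a * a) \<longleftrightarrow>
      \<not> has_inverse (of_real t - adj (unitize a) * unitize a)" if "t > 0" for t
    using cstar_spectrum_iff[of "complex_of_real t" "adj a * a"] that
    by (simp add: unitize_simps scaleC_of_real)
  have "cstar_spectrum (adj a * a) \<inter> complex_of_real ` {0<..<\<epsilon>} = {} \<longleftrightarrow>
      (\<forall>t. 0 < t \<and> t < \<epsilon> \<longrightarrow> complex_of_real t \<notin> cstar_spectrum (adj a * a))" for \<epsilon>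
    by auto
  then show ?thesis
    unfolding closed_range_def gapped_def by (simp add: spec cong: conj_cong imp_cong)
qed

lemma closed_range_iff_regular:
  "closed_range a \<longleftrightarrow> (\<exists>Y. unitize a * Y * unitize a = unitize a)"
  by (simp add: closed_range_iff_gapped gapped_iff_regular)

lemma positive_iff_cpos: "positive b \<longleftrightarrow> cpos (unitize b)"
proof
  assume p: "positive b"
  show "cpos (unitize b)"
    unfolding cpos_def
  proof (intro conjI allI impI)
    show "adj (unitize b) = unitize b"
      using p by (simp add: positive_def flip: unitize_simps)
    fix t :: real assume t: "t > 0"
    have "- complex_of_real t \<notin> cstar_spectrum b"
    proof
      assume "- complex_of_real t \<in> cstar_spectrum b"
      then obtain s where "s \<ge> 0" "- complex_of_real t = complex_of_real s"
        using p unfolding positive_def by auto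
      then show False using t by (metis Re_complex_of_real uminus_complex.sel(1) not_less neg_0_le_iff_le)
    qed
    then have "has_inverse (- (of_real t) - unitize b)"
      using t by (simp add: cstar_spectrum_iff scaleC_minus_left scaleC_of_real)
    from has_inverse_minus[OF this] show "has_inverse (unitize b + of_real t)"
      by simp
  qed
next
  assume p: "cpos (unitize b)"
  have "adj (unitize b) = unitize b" using p by (simp add: cpos_def)
  then have "adj b = b" by (simp add: unitize_inject flip: unitize_simps)
  moreover have "c \<in> complex_of_real ` {0..}" if c: "c \<in> cstar_spectrum b" for c
  proof (rule ccontr)
    assume n: "c \<notin> complex_of_real ` {0..}"
    then have c0: "c \<noteq> 0" by force
    have "Im c = 0"
      using selfadjoint_has_inverse_nonreal[OF \<open>adj (unitize b) = unitize b\<close>] c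
      unfolding cstar_spectrum_iff[OF c0] by blast
    then have cr: "c = complex_of_real (Re c)" by (simp add: complex_eq_iff)
    then have "Re c < 0" using n by (metis atLeast_iff image_eqI not_less)
    then have "has_inverse (unitize b + of_real (- Re c))"
      using p unfolding cpos_def by (meson neg_0_less_iff_less)
    from has_inverse_minus[OF this] have "has_inverse (c *\<^sub>C 1 - unitize b)"
      by (subst cr) (simp add: scaleC_of_real)
    with c show False by (simp add: cstar_spectrum_iff[OF c0])
  qed
  ultimately show "positive b" by (auto simp: positive_def)
qed

section \<open>Modulus, polar part and corner computed in the unitization\<close>

lemma ucoeff_moore_penrose:
  assumes "moore_penrose (unitize a) m"
  shows "ucoeff m = 0"
proof -
  have "m = m * unitize a * m" using assms by (simp add: moore_penrose_def)
  then have "ucoeff m = ucoeff (m * unitize a * m)" by simp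
  then show ?thesis by simp
qed

lemma cstar_abs_unitize: "unitize (cstar_abs a) = psqrt (adj (unitize a) * unitize a)"
proof -
  define h where "h = adj (unitize a) * unitize a"
  have h: "cpos h" unfolding h_def by (rule cpos_adj_mult_self)
  \<comment> \<open>The scalar part is multiplicative, so the root of an element of the algebra
    stays in the algebra.\<close>
  have "ucoeff (psqrt h * psqrt h) = 0"
    unfolding psqrt_square[OF h] by (simp add: h_def)
  then have "ucoeff (psqrt h) = 0"
    by simp
  then obtain b where b: "psqrt h = unitize b"
    using unitize_upart by metis
  have "cstar_abs a = b"
    unfolding cstar_abs_def
  proof (rule the_equality)
    show "positive b \<and> b * b = adj a * a"
      using cpos_psqrt[OF h] psqrt_square[OF h] unfolding b
      by (simp add: positive_iff_cpos h_def unitize_inject flip: unitize_simps)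
    fix c assume c: "positive c \<and> c * c = adj a * a"
    then have "psqrt h = unitize c"
      by (intro psqrt_eqI) (simp_all add: positive_iff_cpos h_def flip: unitize_simps)
    then show "c = b" by (simp add: b unitize_inject)
  qed
  then show ?thesis by (simp add: b flip: h_def)
qed

text \<open>Existence comes from \<open>polar_mp\<close>, whose scalar part vanishes. For
  uniqueness, a competitor has the same support projection and the same product with the modulus,
  which determines it on that support.\<close>

lemma polar_part_unitize:
  assumes mp: "moore_penrose (unitize a) m"
  shows "unitize (polar_part a) = polar_mp (unitize a) m"
proof -
  define A where "A = unitize a"
  note mp = mp[folded A_def]
  have m: "A * m * A = A" "adj (m * A) = m * A"
    using mp by (simp_all add: moore_penrose_def)
  have "ucoeff (polar_mp A m) = 0"
    using ucoeff_moore_penrose[OF assms] by (simp add: polar_mp_def adj_unitization_def)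
  then obtain u where u: "polar_mp A m = unitize u" by (metis unitize_upart)
  define b where "b = cstar_abs a"
  have b: "unitize b = psqrt (adj A * A)" by (simp add: b_def A_def cstar_abs_unitize)
  have "unitize (u * b) = unitize a"
    using polar_mp(1)[OF mp] by (simp add: u unitize_simps b flip: A_def)
  then have ub: "a = u * b" by (simp add: unitize_inject)
  define q where "q = adj u * u"
  have Q: "unitize q = m * A"
    using polar_mp(2)[OF mp] by (simp add: u q_def unitize_simps)
  have "adj (unitize q) = unitize q" "unitize q * unitize q = unitize q" "unitize a * unitize q = unitize a"
    using m by (simp_all add: Q flip: A_def mult.assoc) (metis m(1) mult.assoc)
  then have q: "adj q = q" "q * q = q" "a * q = a"
    by (simp_all add: unitize_inject flip: unitize_simps)
  have least: "q * r = q" if "a * r = a" for r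
  proof -
    have "unitize (q * r) = m * unitize (a * r)"
      by (simp add: unitize_simps Q A_def mult.assoc)
    then have "unitize (q * r) = unitize q" by (simp add: that Q flip: A_def)
    then show ?thesis by (simp only: unitize_inject)
  qed
  have supp: "is_right_support q a"
    using q least by (simp add: is_right_support_def is_projection_def)
  have "polar_part a = u"
    unfolding polar_part_def
  proof (rule the_equality)
    show "partial_isometry u \<and> a = u * cstar_abs a \<and> is_right_support (adj u * u) a"
      using ub supp q by (simp add: partial_isometry_def is_projection_def b_def flip: q_def)
  next
    fix v assume v: "partial_isometry v \<and> a = v * cstar_abs a \<and> is_right_support (adj v * v) a"
    then have vb: "a = v * b" and vs: "is_right_support (adj v * v) a" by (simp_all add: b_def)
    have "(adj v * v) * q = adj v * v" "q * (adj v * v) = q" "adj (adj v * v) = adj v * v"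
      using vs q least by (simp_all add: is_right_support_def is_projection_def)
    then have vq: "adj v * v = q"
      by (metis adj_mult q(1))
    \<comment> \<open>By the C*-identity: \<open>adj (w - w * q) * (w - w * q)\<close> expands into
      four copies of \<open>q\<close> that cancel.\<close>
    have wq: "w * q = w" if "adj w * w = q" for w
    proof -
      have "adj (w - w * q) * (w - w * q) = q - q * q - q * q + q * q * q"
        using that q by (simp add: adj_diff adj_mult algebra_simps) (simp flip: mult.assoc add: that q)
      then have "w - w * q = 0" using adj_mult_self_eq_0[of "w - w * q"] q by simp
      then show ?thesis by simp
    qed
    have badj: "adj (unitize b) = unitize b"
      unfolding b by (rule cpos_adj[OF cpos_psqrt[OF cpos_adj_mult_self]])
    \<comment> \<open>\<open>q\<close> has \<open>b\<close> as a left factor, so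
      \<open>v * b = u * b\<close> forces \<open>v * q = u * q\<close>.\<close>
    have "unitize q = unitize b * (adj (unitize u) * adj m)"
      using arg_cong[OF Q, of adj] q(1) badj
      by (simp add: A_def ub unitize_simps adj_mult mult.assoc) (metis unitize_simps(5))
    moreover have "unitize ((v - u) * b) = 0"
      using ub vb by (simp add: left_diff_distrib unitize_simps)
    then have "(unitize v - unitize u) * unitize b = 0"
      by (simp add: unitize_simps)
    ultimately have "(unitize v - unitize u) * unitize q = 0"
      by (metis mult.assoc mult_zero_left)
    then have "unitize ((v - u) * q) = unitize 0"
      by (simp add: unitize_simps)
    then have "v * q = u * q"
      by (simp only: unitize_inject left_diff_distrib right_minus_eq)
    then show "v = u"
      using wq[OF vq] wq[OF q_def[symmetric]] by simp
  qed
  then show ?thesis by (simp add: u flip: A_def)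
qed

text \<open>In the ambient identity and in \<open>1\<close> alike, multiplication fixes every
  element of the algebra, and products with such elements stay in the algebra, so \<open>1\<close>
  may replace \<open>ambient_one\<close> on both sides. The resulting compression is idempotent, so
  membership becomes a fixed point condition.\<close>

lemma corner_defect_iff:
  assumes mp: "moore_penrose (unitize a) m"
  shows "y \<in> corner (left_defect a) (right_defect a) \<longleftrightarrow>
    (1 - unitize a * m) * unitize y * (1 - m * unitize a) = unitize y"
proof -
  define p q where "p = unitize a * m" and "q = m * unitize a"
  have m: "unitize a * m * unitize a = unitize a"
    using mp by (simp add: moore_penrose_def)
  have pp: "p * p = p" and qq: "q * q = q"
    unfolding p_def q_def using m by (metis mult.assoc)+
  have pq: "unitize (polar_part a * adj (polar_part a)) = p" "unitize (adj (polar_part a) * polar_part a) = q"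
    using polar_mp[OF mp] by (simp_all add: p_def q_def unitize_simps polar_part_unitize[OF mp])
  have eq: "left_defect a * unitize x * right_defect a = (1 - p) * unitize x * (1 - q)" for x
  proof -
    have "left_defect a * unitize x = (1 - p) * unitize x"
      unfolding left_defect_def pq by (simp add: left_diff_distrib ambient_one_mult)
    moreover have "(1 - p) * unitize x = unitize (upart ((1 - p) * unitize x))"
      by (rule unitize_upart[symmetric]) simp
    moreover have "unitize z * right_defect a = unitize z * (1 - q)" for z
      unfolding right_defect_def pq by (simp add: right_diff_distrib ambient_one_mult)
    ultimately show ?thesis by metis
  qed
  have "(1 - p) * ((1 - p) * z * (1 - q)) * (1 - q) = (1 - p) * z * (1 - q)" for z
  proof -
    have "(1 - p) * (1 - p) = 1 - p" "(1 - q) * (1 - q) = 1 - q"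
      by (simp_all add: algebra_simps pp qq)
    then show ?thesis by (metis mult.assoc)
  qed
  then show ?thesis
    unfolding corner_def eq p_def[symmetric] q_def[symmetric] by (auto; metis)
qed

section \<open>Continuity of the polar part\<close>

lemma continuous_polar_part_imp_corner_eq_0:
  fixes a x :: "'a::cstar_algebra"
  assumes a: "closed_range a" and cont: "continuous (at a within {x. closed_range x}) polar_part"
    and x: "x \<in> corner (left_defect a) (right_defect a)" "closed_range x"
  shows "x = 0"
proof -
  define A X where "A = unitize a" and "X = unitize x"
  obtain m n where m: "moore_penrose A m" and n: "moore_penrose X n"
    using a x(2) moore_penrose_of_regular unfolding closed_range_iff_regular A_def X_def by metis
  have AmA: "A * m * A = A" using m by (simp add: moore_penrose_def)
  have X: "(1 - A * m) * X * (1 - m * A) = X"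
    using x(1) corner_defect_iff[of a m x] m by (simp add: A_def X_def)
  have "A * m * (1 - A * m) = 0" "(1 - m * A) * (m * A) = 0"
    using AmA by (simp_all add: left_diff_distrib right_diff_distrib flip: mult.assoc)
      (simp add: mult.assoc)
  then have orth: "A * m * X = 0" "X * (m * A) = 0"
    using X by (metis mult.assoc mult_zero_left, metis mult.assoc mult_zero_right)
  have pa: "unitize (polar_part a) = polar_mp A m" and px: "unitize (polar_part x) = polar_mp X n"
    using polar_part_unitize m n by (simp_all add: A_def X_def)
  have step: "closed_range (a + t *\<^sub>R x)" "polar_part (a + t *\<^sub>R x) = polar_part a + polar_part x"
    if "t > 0" for t
  proof -
    have u: "unitize (a + t *\<^sub>R x) = A + t *\<^sub>R X" by (simp add: A_def X_def unitize_simps)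
    note s = polar_mp_orthogonal_sum[OF m n orth that, folded u]
    show "closed_range (a + t *\<^sub>R x)"
      using moore_penrose_imp_gapped[OF s(1)] by (simp add: closed_range_iff_gapped)
    have "unitize (polar_part (a + t *\<^sub>R x)) = polar_mp A m + polar_mp X n"
      using polar_part_unitize[OF s(1)] s(2) by (simp only:)
    also have "\<dots> = unitize (polar_part a + polar_part x)"
      by (simp only: unitize_simps(1) pa px)
    finally show "polar_part (a + t *\<^sub>R x) = polar_part a + polar_part x"
      by (simp only: unitize_inject)
  qed
  define f where "f k = a + inverse (real (Suc k)) *\<^sub>R x" for k
  have "f \<longlonglongrightarrow> a + 0 *\<^sub>R x"
    unfolding f_def by (intro tendsto_intros LIMSEQ_inverse_real_of_nat)
  then have "(polar_part \<circ> f) \<longlonglongrightarrow> polar_part a"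
    using cont step(1) unfolding continuous_within_sequentially by (simp add: f_def)
  moreover have "polar_part \<circ> f = (\<lambda>_. polar_part a + polar_part x)"
    by (simp add: fun_eq_iff f_def step(2))
  ultimately have "polar_part a + polar_part x = polar_part a"
    by (simp add: LIMSEQ_const_iff)
  then have "polar_mp X n = 0"
    using px by (simp add: unitize_simps)
  then have "X = 0" using polar_mp(1)[OF n] by simp
  then show ?thesis by (simp add: X_def unitize_def zero_unitization_def)
qed

lemma continuous_polar_part_if_corner_eq_0:
  fixes a :: "'a::cstar_algebra"
  assumes a: "closed_range a"
    and corner: "\<And>x. x \<in> corner (left_defect a) (right_defect a) \<Longrightarrow> closed_range x \<Longrightarrow> x = 0"
  shows "continuous (at a within {x. closed_range x}) polar_part"
proof -
  define A where "A = unitize a"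
  obtain m where m: "moore_penrose A m"
    using a moore_penrose_of_regular unfolding closed_range_iff_regular A_def by metis
  have AmA: "A * m * A = A" using m by (simp add: moore_penrose_def)
  define F where "F = at a within {x. closed_range x}"
  define G where "G b = perturbed_inverse A m (unitize b)" for b
  \<comment> \<open>The formula of \<open>moore_penrose_of_regular\<close> as a function of an
    element and a candidate inner inverse. Its limit along \<open>G b\<close> uses only that
    \<open>m * A\<close> and \<open>adj (A * m)\<close> are idempotent; whether \<open>G b\<close>
    is an inner inverse of \<open>b\<close> is settled afterwards.\<close>
  define M where "M B g = rsupp (g * B) * g * rsupp (adj (B * g))" for B g :: "'a unitization"
  have B: "(unitize \<longlongrightarrow> A) F"
    unfolding F_def A_def by (rule bounded_linear.tendsto[OF bounded_linear_unitize tendsto_ident_at])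
  have G: "(G \<longlongrightarrow> m) F"
    unfolding G_def by (rule tendsto_perturbed_inverse[OF B])
  have idem: "(m * A) * (m * A) = m * A" "adj (A * m) * adj (A * m) = adj (A * m)"
    using AmA by (metis mult.assoc, metis adj_mult mult.assoc)
  have "((\<lambda>b. polar_mp (unitize b) (M (unitize b) (G b))) \<longlongrightarrow> polar_mp A (M A m)) F"
    unfolding polar_mp_def M_def
    by (intro tendsto_mult tendsto_adj tendsto_rsupp tendsto_psqrt B G idem always_eventually allI
        cpos_adj_mult_self)
  also have "polar_mp A (M A m) = unitize (polar_part a)"
    unfolding A_def M_def
    by (rule polar_part_unitize[symmetric, OF moore_penrose_of_regular[OF AmA[unfolded A_def]]])
  finally have lim: "((\<lambda>b. polar_mp (unitize b) (M (unitize b) (G b))) \<longlongrightarrow> unitize (polar_part a)) F" .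
  have one: "has_inverse (1 :: 'a unitization)" by (rule has_inverseI[of 1 1]) simp_all
  have "((\<lambda>b. 1 + m * (unitize b - A)) \<longlongrightarrow> 1 + m * (A - A)) F"
    "((\<lambda>b. 1 + (unitize b - A) * m) \<longlongrightarrow> 1 + (A - A) * m) F"
    by (intro tendsto_intros B)+
  then have "\<forall>\<^sub>F b in F. has_inverse (1 + m * (unitize b - A))"
    "\<forall>\<^sub>F b in F. has_inverse (1 + (unitize b - A) * m)"
    by (auto intro!: eventually_has_inverse simp: one)
  moreover have "\<forall>\<^sub>F b in F. closed_range b"
    by (simp add: F_def eventually_at_filter)
  ultimately have "\<forall>\<^sub>F b in F. polar_mp (unitize b) (M (unitize b) (G b)) = unitize (polar_part b)"
  proof eventually_elim
    case (elim b)
    define s where "s = unitize b - unitize b * G b * unitize b"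
    \<comment> \<open>\<open>y\<close> may have a nonzero scalar part. The same \<open>y\<close>
      certifies that the Schur complement has closed range, since
      \<open>closed_range_iff_regular\<close> admits inner inverses from the unitization.\<close>
    obtain y where y: "unitize b * y * unitize b = unitize b"
      using elim(3) unfolding closed_range_iff_regular by blast
    have s1: "(1 - A * m) * s * (1 - m * A) = s" and s2: "s * y * s = s"
      unfolding s_def G_def using perturbed_inverse[OF m elim(1,2)] y by blast+
    have "unitize (upart s) = s"
      by (rule unitize_upart) (simp add: s_def)
    then have "upart s \<in> corner (left_defect a) (right_defect a)" "closed_range (upart s)"
      using s1 s2 corner_defect_iff[OF m[unfolded A_def]] by (auto simp: closed_range_iff_regular A_def)
    then have "upart s = 0" by (rule corner)
    with \<open>unitize (upart s) = s\<close> have "s = 0" by (simp add: unitize_simps)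
    then have "unitize b * G b * unitize b = unitize b" by (simp add: s_def)
    from polar_part_unitize[OF moore_penrose_of_regular[OF this]] show ?case
      by (simp add: M_def)
  qed
  with lim have "((\<lambda>b. unitize (polar_part b)) \<longlongrightarrow> unitize (polar_part a)) F"
    by (rule Lim_transform_eventually)
  from bounded_linear.tendsto[OF bounded_linear_upart this]
  show ?thesis by (simp add: continuous_within F_def)
qed

theorem theorem8:
  fixes a :: "'a::cstar_algebra"
  assumes "closed_range a"
  shows "continuous (at a within {x. closed_range x}) polar_part \<longleftrightarrow>
    {x \<in> corner (left_defect a) (right_defect a). closed_range x} = {0}"
proof -
  have "closed_range (0::'a)"
    by (simp add: closed_range_iff_regular unitize_simps)
  moreover have "unitize 0 = left_defect a * unitize 0 * right_defect a"
    by (simp add: unitize_simps)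
  then have "0 \<in> corner (left_defect a) (right_defect a)"
    unfolding corner_def by blast
  ultimately show ?thesis
    using continuous_polar_part_imp_corner_eq_0[OF assms]
      continuous_polar_part_if_corner_eq_0[OF assms] by blast
qed

end
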